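(* The density of a triangulated (compact) doubly periodic disk packing in the plane in which at least two distinct sizes of disks occur is strictly greater than $\pi/\sqrt{12}$.
   Context: A disk packing in the plane is a collection of closed circular disks (of positive radii) with pairwise disjoint interiors. It is doubly periodic if it is invariant under a lattice of translations with two linearly independent generators, with finitely many disks per fundamental region of the lattice (equivalently, it is a packing of finitely many disks on a flat torus). Its density is the area of the part of a fundamental region covered by the disks divided by the area of the fundamental region. The contact graph of a packing is obtained by joining, by straight segments, the centers of every two tangent disks. The packing is triangulated (or compact) if its contact graph is a triangulation of the plane, i.e. all faces of the contact graph are triangles. *)

theory Defs
  imports "HOL-Analysis.Analysis"
begin

text \<open>A closed disk is given by its center and its radius. Since the radii in a packing are
  positive, distinct pairs give distinct disks.\<close>

type_synonym disk = "(real^2) \<times> real"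

abbreviation center :: "disk \<Rightarrow> real^2" where "center \<equiv> fst"
abbreviation radius :: "disk \<Rightarrow> real" where "radius \<equiv> snd"

definition disk_region :: "disk \<Rightarrow> (real^2) set" where
  "disk_region d = cball (center d) (radius d)"

definition disk_packing :: "disk set \<Rightarrow> bool" where
  "disk_packing P \<longleftrightarrow>
     (\<forall>d\<in>P. radius d > 0) \<and> disjoint_family_on (\<lambda>d. interior (disk_region d)) P"

definition translate_disk :: "real^2 \<Rightarrow> disk \<Rightarrow> disk" where
  "translate_disk w d = (center d + w, radius d)"

definition lattice_gen :: "real^2 \<Rightarrow> real^2 \<Rightarrow> (real^2) set" where
  "lattice_gen u v = {of_int m *\<^sub>R u + of_int n *\<^sub>R v | m n :: int. True}"

text \<open>The half-open parallelogram contains exactly one point of each orbit of the lattice.\<close>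

definition fundamental_region :: "real^2 \<Rightarrow> real^2 \<Rightarrow> (real^2) set" where
  "fundamental_region u v =
     {s *\<^sub>R u + t *\<^sub>R v | s t :: real. 0 \<le> s \<and> s < 1 \<and> 0 \<le> t \<and> t < 1}"

text \<open>The condition \<open>u \<noteq> v\<close> is needed because \<open>{u, v}\<close> is a set.\<close>

definition doubly_periodic :: "disk set \<Rightarrow> real^2 \<Rightarrow> real^2 \<Rightarrow> bool" where
  "doubly_periodic P u v \<longleftrightarrow>
     u \<noteq> v \<and> independent {u, v} \<and>
     (\<forall>w\<in>lattice_gen u v. translate_disk w ` P = P) \<and>
     finite {d\<in>P. center d \<in> fundamental_region u v}"

definition packing_density :: "disk set \<Rightarrow> real^2 \<Rightarrow> real^2 \<Rightarrow> real" where
  "packing_density P u v =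
     measure lebesgue ((\<Union>d\<in>P. disk_region d) \<inter> fundamental_region u v) /
     measure lebesgue (fundamental_region u v)"

text \<open>Disks with disjoint interiors can only be tangent externally.\<close>

definition tangent :: "disk \<Rightarrow> disk \<Rightarrow> bool" where
  "tangent d e \<longleftrightarrow> dist (center d) (center e) = radius d + radius e"

text \<open>The contact graph as a subset of the plane. The centers are included so that a disk
  touching no other disk is an isolated vertex of the graph.\<close>

definition contact_graph :: "disk set \<Rightarrow> (real^2) set" where
  "contact_graph P =
     center ` P \<union>
     \<Union>{closed_segment (center d) (center e) | d e. d \<in> P \<and> e \<in> P \<and> tangent d e}"

definition faces :: "disk set \<Rightarrow> (real^2) set set" where
  "faces P = components (- contact_graph P)"

text \<open>A face is a triangle if it is the open triangle bounded by three edges of the contact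
  graph. The three centers are never collinear, because the radii are positive.\<close>

definition triangulated :: "disk set \<Rightarrow> bool" where
  "triangulated P \<longleftrightarrow>
     (\<forall>F\<in>faces P. \<exists>a\<in>P. \<exists>b\<in>P. \<exists>c\<in>P.
        tangent a b \<and> tangent b c \<and> tangent c a \<and>
        F = interior (convex hull {center a, center b, center c}))"

end

theory Submission
  imports Defs
begin

text \<open>
  Up to a null set, the faces of the contact graph tile the plane by triangles, each spanned by the
  centers of three mutually tangent disks. The theorem holds triangle by triangle: in each of them
  the three disks cover at least the fraction \<open>pi / sqrt 12\<close> of the area, and more than that if the
  three radii are not all equal (\<open>tangent_disks_density\<close>).

  To see this, scale the triangle so that its inscribed circle has radius 1. That circle touches the sides
  where the disks touch each other, so the disk at a vertex with angle \<open>2 * t\<close> has radius \<open>cot t\<close>. The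
  disks cover sectors of areas \<open>t * (cot t)^2\<close>, and the area of the triangle is the sum of the three
  values \<open>cot t\<close>. Hence it suffices that \<open>t * (cot t)^2 - (pi / sqrt 12) * cot t\<close>, summed over three
  positive numbers \<open>t\<close> with sum \<open>pi / 2\<close>, is nonnegative, and zero only if they are equal
  (\<open>sum_excess_ge\<close>). This function of \<open>t\<close> vanishes at \<open>pi / 6\<close> and is strictly convex on the interval from
  \<open>0\<close> to \<open>pi / 2\<close>; as \<open>pi / sqrt 12 < 1\<close>, convexity reduces to
  \<open>3 * sin x < x * (2 + cos x)\<close> at \<open>x = 2 * t\<close> (\<open>cusa_inequality\<close>).

  To pass to the density, the fundamental parallelogram is exchanged for a union of faces, one from
  every orbit under the lattice. Two fundamental domains contain equally much of the covered set, as it is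
  periodic (\<open>emeasure_tiles_eq\<close>).

  Strictness requires a face whose radii are not all equal (\<open>exists_face_unequal_radii\<close>). Two closed
  faces that meet share a vertex (\<open>face_triples_common_vertex\<close>). So if each face had three equal radii, then the
  closed faces of a given radius and those of all other radii would be disjoint. Their unions are closed,
  since the faces are locally finite, and together they are the plane, which is connected.
\<close>

section \<open>The trigonometric inequality\<close>

text \<open>The Cusa-Huygens inequality. It is what makes \<open>excess\<close> below convex.\<close>

lemma cusa_inequality:
  fixes t :: real
  assumes "0 < t" "t < pi"
  shows "3 * sin t < t * (2 + cos t)"
proof -
  have pos: "2 + cos x > 0" for x :: real
    using cos_ge_minus_one[of x] by linarith
  let ?f = "\<lambda>x::real. x - 3 * sin x / (2 + cos x)"
  have "?f 0 < ?f t"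
  proof (rule DERIV_pos_imp_increasing_open[OF assms(1)])
    fix x assume x: "0 < x" "x < t"
    have c1: "cos x < 1"
      using cos_monotone_0_pi[of 0 x] x assms by simp
    have "(?f has_real_derivative (1 - (3 * cos x * (2 + cos x) + 3 * sin x * sin x) / (2 + cos x)^2)) (at x)"
      using pos[of x] by (auto intro!: derivative_eq_intros simp: power2_eq_square)
    moreover have "1 - (3 * cos x * (2 + cos x) + 3 * sin x * sin x) / (2 + cos x)^2
        = ((1 - cos x) / (2 + cos x))^2"
    proof -
      have "sin x * sin x = 1 - cos x * cos x"
        using sin_squared_eq[of x] by (simp add: power2_eq_square)
      then have "3 * sin x * sin x = 3 - 3 * (cos x * cos x)" by simp
      then have "(2 + cos x)^2 - (3 * cos x * (2 + cos x) + 3 * sin x * sin x) = (1 - cos x)^2"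
        by (simp only:) (simp add: power2_eq_square algebra_simps)
      moreover have "1 - A / (2 + cos x)^2 = ((2 + cos x)^2 - A) / (2 + cos x)^2" for A
        using pos[of x] by (simp add: diff_divide_distrib)
      ultimately show ?thesis by (simp only: power_divide)
    qed
    moreover have "((1 - cos x) / (2 + cos x))^2 > 0"
      using c1 pos[of x] by simp
    ultimately show "\<exists>y. (?f has_real_derivative y) (at x) \<and> y > 0" by metis
  next
    show "continuous_on {0..t} ?f"
      by (intro continuous_intros) (metis pos less_irrefl)
  qed
  then have "3 * sin t / (2 + cos t) < t" by simp
  then show ?thesis using pos[of t] by (simp add: field_simps)
qed

lemma above_tangent_strict:
  fixes f f' :: "real \<Rightarrow> real"
  assumes der: "\<And>t. l < t \<Longrightarrow> t < u \<Longrightarrow> (f has_real_derivative f' t) (at t)"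
    and mono: "strict_mono_on {l<..<u} f'"
    and x: "l < x" "x < u" and a: "l < a" "a < u" and ne: "x \<noteq> a"
  shows "f a + f' a * (x - a) < f x"
proof (cases "a < x")
  case True
  obtain z where z: "a < z" "z < x" "f x - f a = (x - a) * f' z"
    using MVT2[OF True, of f f'] der x a by auto
  have "f' a < f' z" using mono z x a by (auto simp: strict_mono_on_def)
  then have "(x - a) * f' a < (x - a) * f' z" using True by simp
  then show ?thesis using z by (simp add: algebra_simps)
next
  case False
  then have lt: "x < a" using ne by simp
  obtain z where z: "x < z" "z < a" "f a - f x = (a - x) * f' z"
    using MVT2[OF lt, of f f'] der x a by auto
  have "f' z < f' a" using mono z x a by (auto simp: strict_mono_on_def)
  then have "(a - x) * f' z < (a - x) * f' a" using lt by simp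
  then show ?thesis using z by (simp add: algebra_simps)
qed

text \<open>Multiplied out, this is \<open>pi / 6 < tan (pi / 6)\<close>.\<close>

lemma pi_less_sqrt_12: "pi < sqrt 12"
proof -
  have der: "(tan has_real_derivative inverse ((cos x)^2)) (at x)" if "0 \<le> x" "x \<le> pi / 6" for x
  proof -
    have "cos x > 0" using that pi_gt_zero by (intro cos_gt_zero_pi) linarith+
    then show ?thesis by (intro DERIV_tan) auto
  qed
  have "0 < pi / 6" using pi_gt_zero by simp
  from MVT2[OF this, of tan "\<lambda>x. inverse ((cos x)^2)"] der
  obtain z where z: "0 < z" "z < pi / 6" "tan (pi / 6) - tan 0 = (pi / 6 - 0) * inverse ((cos z)^2)"
    by blast
  have "0 < cos z" "cos z < 1"
    using z cos_monotone_0_pi[of 0 z] pi_gt_zero by (auto intro!: cos_gt_zero)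
  then have "1 < inverse ((cos z)^2)"
    by (simp add: one_less_inverse power_less_one_iff)
  then have "pi / 6 * 1 < pi / 6 * inverse ((cos z)^2)"
    using pi_gt_zero by (intro mult_strict_left_mono) auto
  then have "pi / 6 < 1 / sqrt 3"
    using z by (simp add: tan_30)
  then have "pi * sqrt 3 < 6" by (simp add: field_simps)
  then have "pi * sqrt 3 * sqrt 3 < 6 * sqrt 3" by simp
  then have "pi < 2 * sqrt 3" by (simp add: mult.assoc)
  moreover have "sqrt 12 = 2 * sqrt 3" using real_sqrt_mult[of 4 3] by simp
  ultimately show ?thesis by simp
qed

text \<open>The density of the hexagonal packing by equal disks.\<close>

definition hex_density :: real where "hex_density = pi / sqrt 12"

text \<open>In a triangle of mutually tangent disks whose inscribed circle has radius 1, let \<open>t\<close> be half of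
  the angle at a vertex. The disk centered there has radius \<open>cot t\<close>, and its sector in the triangle
  has area \<open>t * (cot t)^2\<close>. The radii of the inscribed circle cut the triangle into one kite at
  each vertex, of area \<open>cot t\<close>. So \<open>excess t\<close> is what the vertex contributes to the covered area minus
  \<open>hex_density\<close> times the area.\<close>

definition excess :: "real \<Rightarrow> real"
  where "excess t = t * (cot t)^2 - hex_density * cot t"

text \<open>The derivative of \<open>excess\<close>.\<close>

definition excess' :: "real \<Rightarrow> real"
  where "excess' t = (cot t)^2 + (hex_density - 2 * t * cot t) * (1 + (cot t)^2)"

lemma has_derivative_cot:
  assumes "sin t \<noteq> 0"
  shows "(cot has_real_derivative - (1 + (cot t)^2)) (at t)"
proof -
  have "1 + (cot t)^2 = ((sin t)^2 + (cos t)^2) / (sin t)^2"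
    unfolding add_divide_distrib using assms by (simp add: cot_def power_divide)
  then have "inverse ((sin t)^2) = 1 + (cot t)^2"
    by (simp only: sin_cos_squared_add inverse_eq_divide)
  then show ?thesis using DERIV_cot[OF assms] by simp
qed

lemma has_derivative_excess:
  assumes "0 < t" "t < pi / 2"
  shows "(excess has_real_derivative excess' t) (at t)"
proof -
  have s: "sin t \<noteq> 0" using assms sin_gt_zero[of t] by auto
  show ?thesis unfolding excess_def[abs_def] excess'_def
    by (rule derivative_eq_intros has_derivative_cot s refl)+ (simp add: power2_eq_square algebra_simps)
qed

lemma has_derivative_excess':
  assumes "0 < t" "t < pi / 2"
  shows "(excess' has_real_derivative
    (1 + (cot t)^2) * (2 * t * (1 + 3 * (cot t)^2) - (4 + 2 * hex_density) * cot t)) (at t)"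
proof -
  have s: "sin t \<noteq> 0" using assms sin_gt_zero[of t] by auto
  show ?thesis unfolding excess'_def[abs_def]
    by (rule derivative_eq_intros has_derivative_cot s refl)+ (simp add: power2_eq_square algebra_simps)
qed

lemma hex_density_bounds: "0 < hex_density" "hex_density < 1"
  using pi_less_sqrt_12 pi_gt_zero by (auto simp: hex_density_def)

lemma strict_mono_excess': "strict_mono_on {0<..<pi/2} excess'"
proof (rule strict_mono_onI)
  fix a b assume ab: "a \<in> {0<..<pi/2}" "b \<in> {0<..<pi/2}" "a < b"
  show "excess' a < excess' b"
  proof (rule DERIV_pos_imp_increasing[OF \<open>a < b\<close>])
    fix t assume "a \<le> t" "t \<le> b"
    then have t: "0 < t" "t < pi/2" using ab by auto
    have s: "sin t > 0" and c: "cos t > 0" using t by (auto intro!: sin_gt_zero cos_gt_zero)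
    have "3 * sin (2 * t) < 2 * t * (2 + cos (2 * t))"
      using cusa_inequality[of "2 * t"] t by simp
    also have "2 + cos (2 * t) = (sin t)^2 + 3 * (cos t)^2"
      using sin_cos_squared_add[of t] unfolding cos_double by linarith
    also have "3 * sin (2 * t) = 6 * (cos t * sin t)"
      by (simp add: sin_double)
    finally have "6 * (cos t * sin t) < 2 * t * ((sin t)^2 + 3 * (cos t)^2)" .
    moreover have "hex_density * (cos t * sin t) < 1 * (cos t * sin t)"
      using s c hex_density_bounds by (intro mult_strict_right_mono) auto
    ultimately have "(4 + 2 * hex_density) * (cos t * sin t) < 2 * t * ((sin t)^2 + 3 * (cos t)^2)"
      by (simp add: algebra_simps)
    then have "(4 + 2 * hex_density) * (cos t * sin t) / (sin t)^2 < 2 * t * ((sin t)^2 + 3 * (cos t)^2) / (sin t)^2"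
      using s by (intro divide_strict_right_mono) auto
    also have "(4 + 2 * hex_density) * (cos t * sin t) / (sin t)^2 = (4 + 2 * hex_density) * cot t"
      using s by (simp add: cot_def power2_eq_square)
    also have "2 * t * ((sin t)^2 + 3 * (cos t)^2) / (sin t)^2 = 2 * t * (1 + 3 * (cot t)^2)"
      using s by (simp add: cot_def power_divide add_divide_distrib distrib_left)
    finally have "0 < (1 + (cot t)^2) * (2 * t * (1 + 3 * (cot t)^2) - (4 + 2 * hex_density) * cot t)"
      by (intro mult_pos_pos add_pos_nonneg) auto
    then show "\<exists>y. (excess' has_real_derivative y) (at t) \<and> 0 < y"
      using has_derivative_excess'[OF t] by blast
  qed
qed

lemma excess_pi_6: "excess (pi / 6) = 0"
proof -
  have "sqrt 12 = 2 * sqrt 3" using real_sqrt_mult[of 4 3] by simp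
  then show ?thesis 
    by (simp add: excess_def hex_density_def cot_def cos_30 sin_30 power2_eq_square field_simps)
qed

text \<open>The half-angles of a triangle sum to \<open>pi / 2\<close>, so the tangent line of the strictly convex function
  \<open>excess\<close> at \<open>pi / 6\<close>, where \<open>excess\<close> vanishes, contributes nothing to the sum.\<close>

lemma sum_excess_ge:
  assumes "0 < a" "0 < b" "0 < c" and sum: "a + b + c = pi / 2"
  shows "excess a + excess b + excess c \<ge> 0"
    and "\<not> (a = b \<and> b = c) \<Longrightarrow> excess a + excess b + excess c > 0"
proof -
  have strict: "excess' (pi/6) * (t - pi/6) < excess t"
    if "0 < t" "t < pi/2" "t \<noteq> pi/6" for t
    using above_tangent_strict[OF has_derivative_excess strict_mono_excess' that(1,2) _ _ that(3)]
      excess_pi_6 pi_gt_zero by simp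
  have weak: "excess' (pi/6) * (t - pi/6) \<le> excess t"
    if "0 < t" "t < pi/2" for t
    using strict[OF that] excess_pi_6 by fastforce
  have bd: "a < pi/2" "b < pi/2" "c < pi/2" using assms by auto
  have lin: "excess' (pi/6) * (a - pi/6) + excess' (pi/6) * (b - pi/6) + excess' (pi/6) * (c - pi/6) = 0"
  proof -
    have "excess' (pi/6) * (a - pi/6) + excess' (pi/6) * (b - pi/6) + excess' (pi/6) * (c - pi/6)
      = excess' (pi/6) * (a + b + c - pi/2)" by (simp add: algebra_simps)
    then show ?thesis using sum by simp
  qed
  have weak_abc: "excess' (pi/6) * (a - pi/6) \<le> excess a"
    "excess' (pi/6) * (b - pi/6) \<le> excess b" "excess' (pi/6) * (c - pi/6) \<le> excess c"
    using weak assms bd by blast+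
  show "excess a + excess b + excess c \<ge> 0" using weak_abc lin by linarith
  assume "\<not> (a = b \<and> b = c)"
  then consider "a \<noteq> pi/6" | "b \<noteq> pi/6" | "c \<noteq> pi/6" by metis
  then show "excess a + excess b + excess c > 0"
  proof cases
    case 1 then show ?thesis using strict[of a] weak_abc lin assms bd by linarith
  next
    case 2 then show ?thesis using strict[of b] weak_abc lin assms bd by linarith
  next
    case 3 then show ?thesis using strict[of c] weak_abc lin assms bd by linarith
  qed
qed

lemma arctan_sum_eq_pi_half:
  fixes p q r :: real
  assumes pos: "0 < p" "0 < q" "0 < r" and eq: "p * q + q * r + r * p = 1"
  shows "arctan p + arctan q + arctan r = pi / 2"
proof -
  have "0 < p * q" "0 < q * r" "0 < r * p" using pos by simp_all
  then have pq: "p * q < 1" "0 < p * q" using eq by linarith+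
  have "(p + q) / (1 - p * q) = inverse r"
    using pq pos eq by (simp add: field_simps)
  moreover have "arctan p + arctan q = arctan ((p + q) / (1 - p * q))"
    using pq by (intro arctan_add_small) auto
  ultimately show ?thesis
    using Complex_Transcendental.arctan_inverse[OF pos(3)] by simp
qed

text \<open>Half of the angle at the center of the disk of radius \<open>x\<close>, in the triangle formed by the centers of
  three mutually tangent disks of radii \<open>x\<close>, \<open>y\<close>, \<open>z\<close>.\<close>

definition half_angle :: "real \<Rightarrow> real \<Rightarrow> real \<Rightarrow> real"
  where "half_angle x y z = arctan (sqrt (y * z / (x * (x + y + z))))"

lemma half_angle_bounds:
  assumes "0 < x" "0 < y" "0 < z"
  shows "0 < half_angle x y z" "half_angle x y z < pi / 2"
  using assms arctan_ubound by (auto simp: half_angle_def add_pos_pos)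

text \<open>The square root is the area of the triangle by Heron's formula, since \<open>x + y + z\<close> is half of its
  perimeter, and \<open>covered\<close> is the total area of the three sectors.\<close>

lemma tangent_triangle_inequality:
  assumes pos: "0 < x" "0 < y" "0 < z"
  defines "covered \<equiv> x^2 * half_angle x y z + y^2 * half_angle y z x + z^2 * half_angle z x y"
  shows "hex_density * sqrt (x * y * z * (x + y + z)) \<le> covered"
    and "\<not> (x = y \<and> y = z) \<Longrightarrow> hex_density * sqrt (x * y * z * (x + y + z)) < covered"
proof -
  define s where "s = x + y + z"
  \<comment> \<open>The radius of the inscribed circle, used to scale to the situation of \<open>excess\<close>.\<close>
  define \<rho> where "\<rho> = sqrt (x * y * z / s)"
  have s: "s > 0" using pos by (simp add: s_def)
  have \<rho>: "\<rho> > 0" "\<rho>^2 = x * y * z / s" using pos s by (auto simp: \<rho>_def)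
  have ha: "half_angle a b c = arctan (\<rho> / a)" if "a > 0" "a * b * c = x * y * z" "a + b + c = s" for a b c
  proof -
    have "b * c / (a * s) = (x * y * z / s) / a^2"
      using that s by (simp add: field_simps power2_eq_square flip: that(2))
    then have "sqrt (b * c / (a * s)) = \<rho> / a" using that(1) by (simp only: real_sqrt_divide real_sqrt_abs abs_of_pos \<rho>_def)
    then show ?thesis using that by (simp add: half_angle_def)
  qed
  have ha_x: "half_angle x y z = arctan (\<rho> / x)" and ha_y: "half_angle y z x = arctan (\<rho> / y)"
    and ha_z: "half_angle z x y = arctan (\<rho> / z)"
    by (rule ha; use pos in \<open>simp add: s_def mult_ac add_ac\<close>)+
  have sum: "arctan (\<rho> / x) + arctan (\<rho> / y) + arctan (\<rho> / z) = pi / 2"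
  proof (rule arctan_sum_eq_pi_half)
    have "\<rho> / x * (\<rho> / y) + \<rho> / y * (\<rho> / z) + \<rho> / z * (\<rho> / x) = \<rho>^2 * s / (x * y * z)"
      using pos by (simp add: s_def field_simps power2_eq_square)
    then show "\<rho> / x * (\<rho> / y) + \<rho> / y * (\<rho> / z) + \<rho> / z * (\<rho> / x) = 1"
      using \<rho>(2) s pos by simp
  qed (use pos \<rho> in auto)
  have ex: "\<rho>^2 * excess (arctan (\<rho> / a)) = a^2 * arctan (\<rho> / a) - hex_density * \<rho> * a" if "a > 0" for a
  proof -
    have "cot (arctan (\<rho> / a)) = a / \<rho>" by (simp add: cot_altdef tan_arctan)
    then show ?thesis using \<rho>(1) by (simp add: excess_def power_divide power2_eq_square algebra_simps)
  qed
  have "\<rho> * s = sqrt (x * y * z * s)"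
  proof (rule real_sqrt_unique[symmetric])
    have "(\<rho> * s)^2 = \<rho>^2 * s^2" by (rule power_mult_distrib)
    also have "\<dots> = x * y * z * s" unfolding \<rho>(2) using s by (simp add: power2_eq_square)
    finally show "(\<rho> * s)^2 = x * y * z * s" .
  qed (use \<rho> s in simp)
  then have area: "hex_density * sqrt (x * y * z * (x + y + z)) = hex_density * \<rho> * (x + y + z)"
    unfolding s_def[symmetric] by (simp add: mult.assoc)
  have diff: "covered - hex_density * sqrt (x * y * z * (x + y + z)) =
    \<rho>^2 * (excess (arctan (\<rho> / x)) + excess (arctan (\<rho> / y)) + excess (arctan (\<rho> / z)))"
    unfolding area unfolding distrib_left ex[OF pos(1)] ex[OF pos(2)] ex[OF pos(3)] covered_def ha_x ha_y ha_z
    by (simp add: algebra_simps)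
  have at: "0 < arctan (\<rho> / x)" "0 < arctan (\<rho> / y)" "0 < arctan (\<rho> / z)" using pos \<rho> by auto
  show "hex_density * sqrt (x * y * z * (x + y + z)) \<le> covered"
    using diff mult_nonneg_nonneg[OF zero_le_power2[of \<rho>] sum_excess_ge(1)[OF at sum]]
    by linarith
  assume "\<not> (x = y \<and> y = z)"
  then have "\<not> (arctan (\<rho> / x) = arctan (\<rho> / y) \<and> arctan (\<rho> / y) = arctan (\<rho> / z))"
    using pos \<rho>(1) unfolding arctan_eq_iff by (metis divide_cancel_left less_irrefl)
  then show "hex_density * sqrt (x * y * z * (x + y + z)) < covered"
    using diff mult_pos_pos[OF zero_less_power[OF \<rho>(1), of 2] sum_excess_ge(2)[OF at sum]]
    by linarith
qed

section \<open>The area of a circular sector\<close>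

text \<open>The unit vector at angle \<open>t\<close> to the first coordinate axis.\<close>

definition direction :: "real \<Rightarrow> real^2"
  where "direction t = cos t *\<^sub>R axis 1 1 + sin t *\<^sub>R axis 2 1"

lemma direction_nth: "direction t $ 1 = cos t" "direction t $ 2 = sin t"
  by (simp_all add: direction_def axis_def)

lemma inner_direction: "direction s \<bullet> direction t = cos (s - t)"
  by (simp add: inner_vec_def sum_2 direction_nth cos_diff)

lemma norm_direction [simp]: "norm (direction t) = 1"
  by (simp add: norm_eq_sqrt_inner inner_direction)

lemma direction_interpolate:
  "sin (b - a) *\<^sub>R direction t = sin (b - t) *\<^sub>R direction a + sin (t - a) *\<^sub>R direction b"
proof -
  have "sin (b - a) * cos t = sin (b - t) * cos a + sin (t - a) * cos b"
    by (simp add: sin_diff algebra_simps)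
  moreover have "sin (b - a) * sin t = sin (b - t) * sin a + sin (t - a) * sin b"
    by (simp add: sin_diff algebra_simps)
  ultimately show ?thesis
    by (simp add: vec_eq_iff forall_2 direction_nth)
qed

text \<open>The open sector of the disk with center \<open>p\<close> and radius \<open>R\<close> between the angles \<open>a\<close> and \<open>b\<close>,
  without its center.\<close>

definition open_sector :: "real^2 \<Rightarrow> real \<Rightarrow> real \<Rightarrow> real \<Rightarrow> (real^2) set"
  where "open_sector p R a b = {p + r *\<^sub>R direction t | r t. 0 < r \<and> r < R \<and> a < t \<and> t < b}"

text \<open>Polar coordinates with \<open>r^2 / 2\<close> in place of \<open>r\<close> have Jacobian determinant 1, so the sector has
  the area of a rectangle.\<close>

lemma measure_open_sector:
  assumes "a \<le> b" "b \<le> a + pi" "0 \<le> R"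
  shows "open_sector p R a b \<in> lmeasurable"
    and "measure lebesgue (open_sector p R a b) = R^2 / 2 * (b - a)"
proof -
  define S where "S = box (vector [0, a]) (vector [R^2 / 2, b] :: real^2)"
  define f where "f x = p + sqrt (2 * x $ 1) *\<^sub>R direction (x $ 2)" for x :: "real^2"
  define f' where "f' x h = (h $ 1 / sqrt (2 * x $ 1)) *\<^sub>R direction (x $ 2) +
      (sqrt (2 * x $ 1) * h $ 2) *\<^sub>R (- sin (x $ 2) *\<^sub>R axis 1 1 + cos (x $ 2) *\<^sub>R axis 2 1)"
    for x h :: "real^2"
  have S_iff: "x \<in> S \<longleftrightarrow> 0 < x $ 1 \<and> x $ 1 < R^2 / 2 \<and> a < x $ 2 \<and> x $ 2 < b" for x
    by (auto simp: S_def mem_box_cart forall_2)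
  have image: "f ` S = open_sector p R a b"
  proof (intro equalityI subsetI)
    fix y assume "y \<in> f ` S"
    then obtain x where x: "x \<in> S" "y = f x" by auto
    have "sqrt (2 * x $ 1) < sqrt (R^2)" using x by (simp only: real_sqrt_less_iff) (simp add: S_iff)
    then have "0 < sqrt (2 * x $ 1)" "sqrt (2 * x $ 1) < R" "a < x $ 2" "x $ 2 < b"
      using x assms by (simp_all add: S_iff)
    then show "y \<in> open_sector p R a b"
      unfolding open_sector_def x f_def by blast
  next
    fix y assume "y \<in> open_sector p R a b"
    then obtain r t where rt: "y = p + r *\<^sub>R direction t" "0 < r" "r < R" "a < t" "t < b"
      by (auto simp: open_sector_def)
    let ?x = "vector [r^2 / 2, t] :: real^2"
    have "f ?x = y" using rt by (simp add: f_def)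
    moreover have "r^2 < R^2" using rt by (intro power_strict_mono) auto
    then have "?x \<in> S" using rt by (simp add: S_iff)
    ultimately show "y \<in> f ` S" by blast
  qed
  have der: "(f has_derivative f' x) (at x within S)" if "x \<in> S" for x
  proof -
    have x: "x $ 1 > 0" using that by (simp add: S_iff)
    have 1: "((\<lambda>x::real^2. x $ i) has_derivative (\<lambda>h. h $ i)) (at x within S)" for i
      by (rule bounded_linear_imp_has_derivative[OF bounded_linear_vec_nth])
    have 2: "((\<lambda>x::real^2. sqrt (2 * x $ 1)) has_derivative (\<lambda>h. h $ 1 / sqrt (2 * x $ 1))) (at x within S)"
    proof (rule has_derivative_eq_rhs)
      show "((\<lambda>x::real^2. sqrt (2 * x $ 1)) has_derivative
          (\<lambda>h. 2 * h $ 1 * (inverse (sqrt (2 * x $ 1)) / 2))) (at x within S)"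
      proof (rule DERIV_compose_FDERIV[where f = sqrt and g = "\<lambda>x::real^2. 2 * x $ 1"])
        show "(sqrt has_real_derivative inverse (sqrt (2 * x $ 1)) / 2) (at (2 * x $ 1))"
          by (rule DERIV_real_sqrt) (use x in simp)
        show "((\<lambda>x::real^2. 2 * x $ 1) has_derivative (\<lambda>h. 2 * h $ 1)) (at x within S)"
          by (rule has_derivative_mult_right) (rule 1)
      qed
      have "2 * c * (inverse d / 2) = c / d" for c d :: real by (simp add: inverse_eq_divide)
      then show "(\<lambda>h. 2 * h $ 1 * (inverse (sqrt (2 * x $ 1)) / 2)) = (\<lambda>h. h $ 1 / sqrt (2 * x $ 1))"
        by (simp only:)
    qed
    have 3: "((\<lambda>x::real^2. direction (x $ 2)) has_derivative
        (\<lambda>h. (h $ 2 * - sin (x $ 2)) *\<^sub>R axis 1 1 + (h $ 2 * cos (x $ 2)) *\<^sub>R axis 2 1)) (at x within S)"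
      unfolding direction_def
    proof (intro has_derivative_add has_derivative_scaleR_left)
      show "((\<lambda>x::real^2. cos (x $ 2)) has_derivative (\<lambda>h. h $ 2 * - sin (x $ 2))) (at x within S)"
        by (rule DERIV_compose_FDERIV[where f = cos and g = "\<lambda>x::real^2. x $ 2", OF DERIV_cos 1])
      show "((\<lambda>x::real^2. sin (x $ 2)) has_derivative (\<lambda>h. h $ 2 * cos (x $ 2))) (at x within S)"
        by (rule DERIV_compose_FDERIV[where f = sin and g = "\<lambda>x::real^2. x $ 2", OF DERIV_sin 1])
    qed
    have "(f has_derivative (\<lambda>h. 0 + (sqrt (2 * x $ 1) *\<^sub>R
          ((h $ 2 * - sin (x $ 2)) *\<^sub>R axis 1 1 + (h $ 2 * cos (x $ 2)) *\<^sub>R axis 2 1)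
        + (h $ 1 / sqrt (2 * x $ 1)) *\<^sub>R direction (x $ 2)))) (at x within S)"
      unfolding f_def[abs_def] 
      by (rule has_derivative_add[OF has_derivative_const has_derivative_scaleR[OF 2 3]])
    moreover have "0 + (\<sigma> *\<^sub>R ((k * - s) *\<^sub>R e + (k * c) *\<^sub>R e') + w)
        = w + (\<sigma> * k) *\<^sub>R (- s *\<^sub>R e + c *\<^sub>R e')" for \<sigma> k s c :: real and e e' w :: "real^2"
      by (simp add: scaleR_add_right scaleR_diff_right mult.assoc)
    ultimately show ?thesis
      unfolding f'_def by (simp only:)
  qed
  have det: "\<bar>det (matrix (f' x))\<bar> = 1" if "x \<in> S" for x
  proof -
    define \<sigma> where "\<sigma> = sqrt (2 * x $ 1)"
    have "\<sigma> > 0" using that by (simp add: S_iff \<sigma>_def)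
    moreover have "cos (x $ 2) * cos (x $ 2) + sin (x $ 2) * sin (x $ 2) = 1"
      by (metis power2_eq_square sin_cos_squared_add2)
    ultimately show ?thesis
      unfolding det_2 matrix_def f'_def \<sigma>_def[symmetric]
      by (simp add: direction_nth axis_def)
  qed
  have inj: "inj_on f S"
  proof (rule inj_onI)
    fix x y assume xy: "x \<in> S" "y \<in> S" "f x = f y"
    then have eq: "sqrt (2 * x $ 1) *\<^sub>R direction (x $ 2) = sqrt (2 * y $ 1) *\<^sub>R direction (y $ 2)"
      by (simp add: f_def)
    from arg_cong[OF this, of norm] have r: "sqrt (2 * x $ 1) = sqrt (2 * y $ 1)"
      using xy by (simp add: S_iff)
    then have "direction (x $ 2) = direction (y $ 2)"
      using eq xy by (simp add: S_iff)
    then have "cos (x $ 2 - y $ 2) = 1"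
      by (metis inner_direction cos_zero diff_self)
    then have "cos \<bar>x $ 2 - y $ 2\<bar> = 1" by simp
    moreover have "\<bar>x $ 2 - y $ 2\<bar> < pi" using xy assms by (auto simp: S_iff abs_less_iff)
    ultimately have "x $ 2 = y $ 2"
      using cos_monotone_0_pi[of 0 "\<bar>x $ 2 - y $ 2\<bar>"] by force
    then show "x = y" using r by (simp add: vec_eq_iff forall_2)
  qed
  have S: "S \<in> lmeasurable" by (simp add: S_def)
  have one: "((\<lambda>x. \<bar>det (matrix (f' x))\<bar>) has_integral measure lebesgue S) S"
  proof (rule has_integral_eq[of S "\<lambda>x. 1"])
    show "((\<lambda>x. 1) has_integral measure lebesgue S) S"
      unfolding lmeasure_integral[OF S] by (rule integrable_integral) (rule integrable_on_const[OF S])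
  qed (simp add: det)
  have "measure lebesgue (f ` S) = measure lebesgue S"
    using measure_differentiable_image_eq[OF _ der inj] one S by (auto simp: integral_unique has_integral_integrable)
  moreover have "measure lebesgue S = R^2 / 2 * (b - a)"
  proof -
    let ?l = "vector [0, a] :: real^2" and ?u = "vector [R^2 / 2, b] :: real^2"
    have "measure lebesgue S = measure lborel (box ?l ?u)" by (simp add: S_def)
    also have "\<dots> = measure lborel (cbox ?l ?u)"
      unfolding measure_lborel_box_eq measure_lborel_cbox_eq ..
    also have "\<dots> = (\<Prod>i\<in>UNIV. ?u $ i - ?l $ i)"
      by (rule content_cbox_cart) (use assms in \<open>simp add: interval_ne_empty_cart forall_2\<close>)
    also have "\<dots> = R^2 / 2 * (b - a)" by (simp add: UNIV_2)
    finally show ?thesis .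
  qed
  ultimately show "measure lebesgue (open_sector p R a b) = R^2 / 2 * (b - a)"
    by (simp add: image)
  show "open_sector p R a b \<in> lmeasurable"
    using measurable_differentiable_image_eq[OF _ der inj] one S
    by (auto simp: image[symmetric] has_integral_integrable)
qed

section \<open>Triangles of mutually tangent disks\<close>

lemma unit_vector_direction:
  fixes w :: "real^2"
  assumes "norm w = 1"
  obtains t where "w = direction t"
proof -
  have "(w $ 1)^2 + (w $ 2)^2 = 1"
    using assms by (simp add: norm_eq_sqrt_inner inner_vec_def sum_2 power2_eq_square)
  then obtain t where "w $ 1 = cos t" "w $ 2 = sin t" by (rule sincos_total_2pi)
  then show thesis by (intro that[of t]) (simp add: vec_eq_iff forall_2 direction_nth)
qed

lemma unit_vectors_at_angle:
  fixes w w' :: "real^2"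
  assumes "norm w = 1" "norm w' = 1" "w \<bullet> w' = cos \<phi>"
  obtains t where "w = direction t" "w' = direction (t + \<phi>)"
    | t where "w' = direction t" "w = direction (t + \<phi>)"
proof -
  obtain s where s: "w = direction s" using unit_vector_direction[OF assms(1)] .
  obtain t where t: "w' = direction t" using unit_vector_direction[OF assms(2)] .
  have c: "cos (t - s) = cos \<phi>" using assms(3) by (simp add: s t inner_direction cos_diff mult.commute)
  have "(sin (t - s))^2 = (sin \<phi>)^2" using c by (simp add: sin_squared_eq)
  then consider "sin (t - s) = sin \<phi>" | "sin (t - s) = - sin \<phi>" by (auto simp: power2_eq_iff)
  then show thesis
  proof cases
    case 1
    have "direction (s + (t - s)) = direction (s + \<phi>)"
      unfolding direction_def cos_add sin_add c 1 ..
    then show thesis using s t that(1) by simp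
  next
    case 2
    have "direction (t - (t - s)) = direction (t + \<phi>)"
      unfolding direction_def cos_add sin_add cos_diff[of t "t - s"] sin_diff[of t "t - s"] c 2 by simp
    then show thesis using s t that(2) by simp
  qed
qed

text \<open>The right-hand side is what the law of cosines gives for the sides \<open>x + y\<close>, \<open>x + z\<close> and \<open>y + z\<close>.\<close>

lemma cos_double_half_angle:
  assumes "0 < x" "0 < y" "0 < z"
  shows "cos (2 * half_angle x y z) = ((x + y)^2 + (x + z)^2 - (y + z)^2) / (2 * ((x + y) * (x + z)))"
proof -
  define q where "q = y * z / (x * (x + y + z))"
  have q: "q > 0" using assms by (simp add: q_def add_pos_pos)
  have "cos (2 * half_angle x y z) = 2 * (cos (arctan (sqrt q)))^2 - 1"
    by (simp add: half_angle_def q_def cos_double_cos)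
  also have "\<dots> = 2 / (1 + q) - 1" using q by (simp add: cos_arctan power_divide)
  also have "1 + q = (x + y) * (x + z) / (x * (x + y + z))"
    using assms by (simp add: q_def add_divide_eq_iff add_pos_pos) (simp add: algebra_simps)
  also have "2 / ((x + y) * (x + z) / (x * (x + y + z))) - 1 =
      (4 * (x * (x + y + z)) - 2 * ((x + y) * (x + z))) / (2 * ((x + y) * (x + z)))"
  proof -
    have "2 / (A / B) - 1 = (4 * B - 2 * A) / (2 * A)" if "A > 0" for A B :: real
      using that by (simp add: field_simps)
    from this[of "(x + y) * (x + z)" "x * (x + y + z)"] show ?thesis
      using assms by simp
  qed
  also have "4 * (x * (x + y + z)) - 2 * ((x + y) * (x + z)) = (x + y)^2 + (x + z)^2 - (y + z)^2"
    by (simp add: power2_eq_square algebra_simps)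
  finally show ?thesis .
qed

lemma not_collinear_tangent:
  fixes p q r :: "real^2"
  assumes pos: "0 < x" "0 < y" "0 < z"
    and d: "dist p q = x + y" "dist q r = y + z" "dist r p = z + x"
  shows "\<not> collinear {p, q, r}"
  using assms unfolding collinear_between_cases between by (auto simp: dist_commute)

lemma segment_covered_by_disks:
  fixes q r :: "real^2"
  assumes "dist q r = y + z" and m: "m \<in> closed_segment q r"
  shows "dist m q \<le> y \<or> dist m r \<le> z"
proof -
  have "dist q m + dist m r = y + z" using m assms(1) by (metis between between_mem_segment)
  then show ?thesis by (auto simp: dist_commute)
qed

text \<open>A disk of the triple does not reach across the opposite side of the triangle, because the other two
  disks cover that side.\<close>

lemma open_sector_subset_triangle:
  fixes p q r :: "real^2"
  assumes pos: "0 < x" "0 < y" "0 < z"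
    and d: "dist p q = x + y" "dist q r = y + z" "dist r p = z + x"
    and q: "q = p + (x + y) *\<^sub>R direction a" and r: "r = p + (x + z) *\<^sub>R direction b"
    and ab: "a < b" "b < a + pi"
  shows "open_sector p x a b \<subseteq> interior (convex hull {p, q, r})"
proof
  fix v assume "v \<in> open_sector p x a b"
  then obtain \<rho> t where v: "v = p + \<rho> *\<^sub>R direction t" and \<rho>: "0 < \<rho>" "\<rho> < x" and t: "a < t" "t < b"
    by (auto simp: open_sector_def)
  have s: "sin (b - a) > 0" "sin (b - t) > 0" "sin (t - a) > 0"
    using ab t by (auto intro!: sin_gt_zero)
  \<comment> \<open>The barycentric coordinates of \<open>v\<close> with respect to \<open>q\<close> and \<open>r\<close>.\<close>
  define \<beta> where "\<beta> = \<rho> * (sin (b - t) / sin (b - a)) / (x + y)"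
  define \<gamma> where "\<gamma> = \<rho> * (sin (t - a) / sin (b - a)) / (x + z)"
  have bc: "\<beta> > 0" "\<gamma> > 0" using \<rho> s pos by (auto simp: \<beta>_def \<gamma>_def)
  have dir: "direction t = (sin (b - t) / sin (b - a)) *\<^sub>R direction a + (sin (t - a) / sin (b - a)) *\<^sub>R direction b"
  proof -
    have "direction t = (1 / sin (b - a)) *\<^sub>R (sin (b - a) *\<^sub>R direction t)" using s by simp
    also have "\<dots> = (sin (b - t) / sin (b - a)) *\<^sub>R direction a + (sin (t - a) / sin (b - a)) *\<^sub>R direction b"
      by (subst direction_interpolate) (simp add: scaleR_add_right)
    finally show ?thesis .
  qed
  have v': "v = p + \<beta> *\<^sub>R (q - p) + \<gamma> *\<^sub>R (r - p)"
  proof -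
    have "\<beta> *\<^sub>R (q - p) = (\<rho> * (sin (b - t) / sin (b - a))) *\<^sub>R direction a"
      using pos by (simp add: q \<beta>_def)
    moreover have "\<gamma> *\<^sub>R (r - p) = (\<rho> * (sin (t - a) / sin (b - a))) *\<^sub>R direction b"
      using pos by (simp add: r \<gamma>_def)
    ultimately show ?thesis unfolding v by (subst dir) (simp add: scaleR_add_right)
  qed
  have sum: "\<beta> + \<gamma> < 1"
  proof (rule ccontr)
    assume ge: "\<not> \<beta> + \<gamma> < 1"
    \<comment> \<open>The ray from \<open>p\<close> through \<open>v\<close> meets the opposite side at \<open>m\<close>, no later than at \<open>v\<close>.\<close>
    define m where "m = p + (1 / (\<beta> + \<gamma>)) *\<^sub>R (v - p)"
    have "m = (\<beta> / (\<beta> + \<gamma>)) *\<^sub>R q + (\<gamma> / (\<beta> + \<gamma>)) *\<^sub>R r"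
    proof -
      have "\<beta> / (\<beta> + \<gamma>) + \<gamma> / (\<beta> + \<gamma>) = 1" using bc by (simp flip: add_divide_distrib)
      then have "p = (\<beta> / (\<beta> + \<gamma>)) *\<^sub>R p + (\<gamma> / (\<beta> + \<gamma>)) *\<^sub>R p" by (metis scaleR_add_left scaleR_one)
      then show ?thesis unfolding m_def v' by (simp add: algebra_simps)
    qed
    moreover have "\<beta> / (\<beta> + \<gamma>) = 1 - \<gamma> / (\<beta> + \<gamma>)" using bc by (simp add: field_simps)
    ultimately have "m \<in> closed_segment q r"
      using bc unfolding in_segment by (intro exI[of _ "\<gamma> / (\<beta> + \<gamma>)"]) auto
    then have "dist m q \<le> y \<or> dist m r \<le> z" using d segment_covered_by_disks by blast
    moreover have "dist p m \<le> \<rho>"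
    proof -
      have "dist p m = \<rho> / (\<beta> + \<gamma>)" using bc \<rho> by (simp add: m_def v dist_norm)
      also have "\<dots> \<le> \<rho>" using ge \<rho> by (simp add: divide_le_eq)
      finally show ?thesis .
    qed
    ultimately show False
      using d \<rho> dist_triangle[of p q m] dist_triangle[of p r m] by (auto simp: dist_commute)
  qed
  have "v = (1 - \<beta> - \<gamma>) *\<^sub>R p + \<beta> *\<^sub>R q + \<gamma> *\<^sub>R r" unfolding v' by (simp add: algebra_simps)
  moreover have "\<not> collinear {p, q, r}" using not_collinear_tangent[OF pos d] .
  ultimately show "v \<in> interior (convex hull {p, q, r})"
    using bc sum
    by (subst interior_convex_hull_3_minimal, simp, simp, intro CollectI exI[of _ "1 - \<beta> - \<gamma>"]
      exI[of _ \<beta>] exI[of _ \<gamma>] conjI) auto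
qed

lemma open_sector_subset_ball: "open_sector p R a b \<subseteq> ball p R"
  by (auto simp: open_sector_def dist_norm)

lemma sector_in_tangent_triangle:
  fixes p q r :: "real^2"
  assumes pos: "0 < x" "0 < y" "0 < z"
    and d: "dist p q = x + y" "dist q r = y + z" "dist r p = z + x"
  obtains S where "S \<in> lmeasurable" "S \<subseteq> ball p x" "S \<subseteq> interior (convex hull {p, q, r})"
    "measure lebesgue S = x^2 * half_angle x y z"
proof -
  define w where "w = (1 / (x + y)) *\<^sub>R (q - p)"
  define w' where "w' = (1 / (x + z)) *\<^sub>R (r - p)"
  define \<phi> where "\<phi> = 2 * half_angle x y z"
  have \<phi>: "0 < \<phi>" "\<phi> < pi" using half_angle_bounds[OF pos] by (auto simp: \<phi>_def)
  have n: "norm (q - p) = x + y" "norm (r - p) = x + z" "norm ((q - p) - (r - p)) = y + z"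
    using d by (auto simp: dist_norm norm_minus_commute)
  have "2 * (v \<bullet> v') = (norm v)^2 + (norm v')^2 - (norm (v - v'))^2" for v v' :: "real^2"
    using inner_commute[of v v'] by (simp add: power2_norm_eq_inner inner_diff_left inner_diff_right)
  from this[of "q - p" "r - p"]
  have "2 * ((q - p) \<bullet> (r - p)) = (x + y)^2 + (x + z)^2 - (y + z)^2"
    by (simp only: n)
  moreover have "w \<bullet> w' = 2 * ((q - p) \<bullet> (r - p)) / (2 * ((x + y) * (x + z)))"
    by (simp add: w_def w'_def mult.commute[of "x + z"])
  ultimately have ww: "w \<bullet> w' = cos \<phi>"
    by (simp add: \<phi>_def cos_double_half_angle[OF pos])
  have nw: "norm w = 1" "norm w' = 1" using n pos by (auto simp: w_def w'_def)
  have q: "q = p + (x + y) *\<^sub>R w" and r: "r = p + (x + z) *\<^sub>R w'" using pos by (auto simp: w_def w'_def)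
  have meas: "open_sector p x t (t + \<phi>) \<in> lmeasurable"
    "measure lebesgue (open_sector p x t (t + \<phi>)) = x^2 * half_angle x y z" for t
    using measure_open_sector[of t "t + \<phi>" x p] \<phi> pos by (auto simp: \<phi>_def)
  from unit_vectors_at_angle[OF nw ww] show thesis
  proof cases
    case (1 t)
    have "open_sector p x t (t + \<phi>) \<subseteq> interior (convex hull {p, q, r})"
      using open_sector_subset_triangle[OF pos d] q r 1 \<phi> by simp
    then show thesis by (rule that[OF meas(1) open_sector_subset_ball _ meas(2)])
  next
    case (2 t)
    have "open_sector p x t (t + \<phi>) \<subseteq> interior (convex hull {p, r, q})"
    proof (rule open_sector_subset_triangle)
      show "dist p r = x + z" "dist r q = z + y" "dist q p = y + x"
        using d dist_commute[of p r] dist_commute[of r q] dist_commute[of q p] by linarith+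
      show "r = p + (x + z) *\<^sub>R direction t" "q = p + (x + y) *\<^sub>R direction (t + \<phi>)"
        using q r 2 by simp_all
    qed (use pos \<phi> in auto)
    then have "open_sector p x t (t + \<phi>) \<subseteq> interior (convex hull {p, q, r})"
      by (simp only: insert_commute[of r q])
    then show thesis by (rule that[OF meas(1) open_sector_subset_ball _ meas(2)])
  qed
qed

lemma measure_triangle:
  fixes p q r :: "real^2"
  assumes d: "dist p q = x + y" "dist q r = y + z" "dist r p = z + x"
  shows "measure lebesgue (interior (convex hull {p, q, r})) = sqrt (x * y * z * (x + y + z))"
proof -
  have "measure lebesgue (interior (convex hull {p, q, r})) = measure lebesgue (convex hull {p, q, r})"
    by (rule measure_interior) (auto simp: finite_imp_bounded_convex_hull intro!: negligible_convex_frontier)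
  also have "\<dots> = sqrt (x * y * z * (x + y + z))"
  proof -
    have "convex hull {p, q, r} \<in> sets borel"
      by (intro borel_compact compact_convex_hull finite_imp_compact) auto
    then have "measure lebesgue (convex hull {p, q, r}) = measure lborel (convex hull {p, q, r})" by simp
    also have "\<dots> = sqrt (x * y * z * (x + y + z))"
    proof -
      have "(dist q r + dist p r + dist p q) / 2 = x + y + z"
        using d by (simp add: dist_commute[of p r])
      then show ?thesis
        using d by (subst heron, simp only:) (simp add: dist_commute[of p r] mult_ac)
    qed
    finally show ?thesis .
  qed
  finally show ?thesis .
qed

text \<open>A triangle of mutually tangent disks is covered with density at least \<open>hex_density\<close>, and more if the
  radii differ. Further disks can only increase the covered set \<open>U\<close>.\<close>

lemma tangent_disks_density:
  fixes p q r :: "real^2"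
  assumes pos: "0 < x" "0 < y" "0 < z"
    and d: "dist p q = x + y" "dist q r = y + z" "dist r p = z + x"
    and U: "U \<in> sets lebesgue" "cball p x \<union> cball q y \<union> cball r z \<subseteq> U"
  defines "T \<equiv> interior (convex hull {p, q, r})"
  shows "hex_density * measure lebesgue T \<le> measure lebesgue (U \<inter> T)"
    and "\<not> (x = y \<and> y = z) \<Longrightarrow> hex_density * measure lebesgue T < measure lebesgue (U \<inter> T)"
proof -
  obtain A where A: "A \<in> lmeasurable" "A \<subseteq> ball p x" "A \<subseteq> T" "measure lebesgue A = x^2 * half_angle x y z"
    using sector_in_tangent_triangle[OF pos d] unfolding T_def by blast
  obtain B where B: "B \<in> lmeasurable" "B \<subseteq> ball q y" "B \<subseteq> T" "measure lebesgue B = y^2 * half_angle y z x"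
    using sector_in_tangent_triangle[OF pos(2,3,1) d(2,3,1)] unfolding T_def by (auto simp: insert_commute)
  obtain C where C: "C \<in> lmeasurable" "C \<subseteq> ball r z" "C \<subseteq> T" "measure lebesgue C = z^2 * half_angle z x y"
    using sector_in_tangent_triangle[OF pos(3,1,2) d(3,1,2)] unfolding T_def by (auto simp: insert_commute)
  have T: "T \<in> lmeasurable" unfolding T_def
    by (intro lmeasurable_open bounded_interior finite_imp_bounded_convex_hull) auto
  have "A \<inter> B = {}" "(A \<union> B) \<inter> C = {}"
    using A(2) B(2) C(2) disjoint_ballI[of x y p q] disjoint_ballI[of y z q r] disjoint_ballI[of z x r p] d
    by auto
  then have "measure lebesgue (A \<union> B \<union> C) = measure lebesgue A + measure lebesgue B + measure lebesgue C"
    using A(1) B(1) C(1) by (simp add: measure_Un3 fmeasurable.Un)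
  moreover have "measure lebesgue (A \<union> B \<union> C) \<le> measure lebesgue (U \<inter> T)"
  proof (rule measure_mono_fmeasurable)
    show "A \<union> B \<union> C \<subseteq> U \<inter> T"
      using A(2,3) B(2,3) C(2,3) U(2) ball_subset_cball by blast
    show "A \<union> B \<union> C \<in> sets lebesgue" using A(1) B(1) C(1) by auto
    show "U \<inter> T \<in> lmeasurable" using fmeasurable_Int_fmeasurable[OF T U(1)] by (simp add: Int_commute)
  qed
  ultimately have le: "x^2 * half_angle x y z + y^2 * half_angle y z x + z^2 * half_angle z x y \<le> measure lebesgue (U \<inter> T)"
    using A B C by simp
  show "hex_density * measure lebesgue T \<le> measure lebesgue (U \<inter> T)"
    using tangent_triangle_inequality(1)[OF pos] le measure_triangle[OF d] by (simp add: T_def)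
  show "hex_density * measure lebesgue T < measure lebesgue (U \<inter> T)" if "\<not> (x = y \<and> y = z)"
    using tangent_triangle_inequality(2)[OF pos that] le measure_triangle[OF d] by (simp add: T_def)
qed

section \<open>Lattices and fundamental domains\<close>

lemma lattice_gen_minus: "w \<in> lattice_gen u v \<Longrightarrow> - w \<in> lattice_gen u v"
  unfolding lattice_gen_def
proof clarify
  fix m n :: int
  show "\<exists>m' n'. - (of_int m *\<^sub>R u + of_int n *\<^sub>R v) = of_int m' *\<^sub>R u + of_int n' *\<^sub>R v \<and> True"
    by (rule exI[of _ "- m"], rule exI[of _ "- n"]) simp
qed

lemma countable_lattice_gen: "countable (lattice_gen u v)"
proof -
  have "lattice_gen u v = (\<lambda>(m, n). of_int m *\<^sub>R u + of_int n *\<^sub>R v) ` UNIV"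
    by (auto simp: lattice_gen_def)
  then show ?thesis by simp
qed

lemma independent_pair_coords_unique:
  assumes "u \<noteq> v" "independent {u, v}" and eq: "s *\<^sub>R u + t *\<^sub>R v = s' *\<^sub>R u + t' *\<^sub>R v"
  shows "s = s' \<and> t = t'"
proof -
  have 0: "(s - s') *\<^sub>R u + (t - t') *\<^sub>R v = 0" using eq by (simp add: algebra_simps)
  have "u \<notin> span {v}" "v \<notin> span {u}"
    using assms(1,2) independent_insert[of u "{v}"] independent_insert[of v "{u}"]
    by (auto simp: insert_commute)
  have "s = s'"
  proof (rule ccontr)
    assume ne: "s \<noteq> s'"
    have "(s - s') *\<^sub>R u = - ((t - t') *\<^sub>R v)" using 0 by (simp add: add_eq_0_iff2)
    then have "(1 / (s - s')) *\<^sub>R ((s - s') *\<^sub>R u) = (1 / (s - s')) *\<^sub>R (- ((t - t') *\<^sub>R v))" by simp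
    then have "u = - (((t - t') / (s - s')) *\<^sub>R v)" using ne by simp
    then show False using \<open>u \<notin> span {v}\<close> by (metis insertI1 span_base span_scale span_neg)
  qed
  moreover have "t = t'"
  proof -
    have "v \<noteq> 0" using \<open>v \<notin> span {u}\<close> span_zero by metis
    then show ?thesis using 0 \<open>s = s'\<close> by simp
  qed
  ultimately show ?thesis ..
qed

lemma independent_pair_coords:
  fixes u v x :: "real^2"
  assumes "u \<noteq> v" "independent {u, v}"
  obtains s t where "x = s *\<^sub>R u + t *\<^sub>R v"
proof -
  have "UNIV \<subseteq> span {u, v}"
    using assms by (intro card_ge_dim_independent) auto
  then have "x \<in> span {u, v}" by blast
  then obtain s where "x - s *\<^sub>R u \<in> span {v}" by (auto simp: span_insert)
  then obtain t where "x - s *\<^sub>R u = t *\<^sub>R v" by (auto simp: span_singleton)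
  then show thesis by (intro that[of s t]) (simp add: algebra_simps)
qed

lemma fundamental_region_measurable: "fundamental_region u v \<in> lmeasurable"
proof (rule measurable_convex)
  show "convex (fundamental_region u v)"
  proof (rule convexI)
    fix x y a b assume "x \<in> fundamental_region u v" "y \<in> fundamental_region u v"
      and ab: "0 \<le> a" "0 \<le> b" "a + b = (1::real)"
    then obtain s t s' t' where x: "x = s *\<^sub>R u + t *\<^sub>R v" and y: "y = s' *\<^sub>R u + t' *\<^sub>R v"
      and st: "s \<in> {0..<1}" "t \<in> {0..<1}" "s' \<in> {0..<1}" "t' \<in> {0..<1}"
      by (auto simp: fundamental_region_def)
    have c: "a * p + b * q \<in> {0..<1}" if "p \<in> {0..<1}" "q \<in> {0..<1}" for p q
      using convexD[of "{0..<1::real}", OF _ that ab] by simp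
    have "a *\<^sub>R x + b *\<^sub>R y = (a * s + b * s') *\<^sub>R u + (a * t + b * t') *\<^sub>R v"
      unfolding x y by (simp add: algebra_simps)
    then show "a *\<^sub>R x + b *\<^sub>R y \<in> fundamental_region u v"
      using c[OF st(1,3)] c[OF st(2,4)] unfolding fundamental_region_def by auto
  qed
  show "bounded (fundamental_region u v)"
  proof (rule boundedI)
    fix x assume "x \<in> fundamental_region u v"
    then obtain s t where x: "x = s *\<^sub>R u + t *\<^sub>R v" and st: "0 \<le> s" "s < 1" "0 \<le> t" "t < 1"
      by (auto simp: fundamental_region_def)
    have "norm x \<le> s * norm u + t * norm v"
      unfolding x using st by (intro norm_triangle_le) simp
    also have "\<dots> \<le> norm u + norm v"
      using st by (intro add_mono mult_left_le_one_le) auto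
    finally show "norm x \<le> norm u + norm v" .
  qed
qed

lemma lattice_translate_into_region:
  fixes u v x :: "real^2"
  assumes "u \<noteq> v" "independent {u, v}"
  obtains w where "w \<in> lattice_gen u v" "x - w \<in> fundamental_region u v"
proof -
  obtain s t where x: "x = s *\<^sub>R u + t *\<^sub>R v" using independent_pair_coords[OF assms] .
  define w where "w = of_int \<lfloor>s\<rfloor> *\<^sub>R u + of_int \<lfloor>t\<rfloor> *\<^sub>R v"
  have "x - w = frac s *\<^sub>R u + frac t *\<^sub>R v" by (simp add: x w_def frac_def algebra_simps)
  then have "x - w \<in> fundamental_region u v"
    unfolding fundamental_region_def by (metis (mono_tags, lifting) CollectI frac_ge_0 frac_lt_1)
  moreover have "w \<in> lattice_gen u v" unfolding lattice_gen_def w_def by blast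
  ultimately show thesis using that by blast
qed

lemma lattice_translate_into_region_unique:
  fixes u v x :: "real^2"
  assumes uv: "u \<noteq> v" "independent {u, v}"
    and w: "w \<in> lattice_gen u v" "w' \<in> lattice_gen u v"
    and x: "x - w \<in> fundamental_region u v" "x - w' \<in> fundamental_region u v"
  shows "w = w'"
proof -
  obtain m n m' n' :: int where w_eq: "w = of_int m *\<^sub>R u + of_int n *\<^sub>R v" "w' = of_int m' *\<^sub>R u + of_int n' *\<^sub>R v"
    using w by (auto simp: lattice_gen_def)
  obtain s t s' t' where xw: "x - w = s *\<^sub>R u + t *\<^sub>R v" "x - w' = s' *\<^sub>R u + t' *\<^sub>R v"
    and st: "s \<in> {0..<1}" "t \<in> {0..<1}" "s' \<in> {0..<1}" "t' \<in> {0..<1}"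
    using x by (auto simp: fundamental_region_def)
  have "(of_int m + s) *\<^sub>R u + (of_int n + t) *\<^sub>R v = w + (x - w)"
    by (subst xw(1), subst w_eq(1)) (simp add: algebra_simps)
  also have "\<dots> = w' + (x - w')" by simp
  also have "\<dots> = (of_int m' + s') *\<^sub>R u + (of_int n' + t') *\<^sub>R v"
    by (subst xw(2), subst w_eq(2)) (simp add: algebra_simps)
  finally have "of_int m + s = of_int m' + s'" "of_int n + t = of_int n' + t'"
    using independent_pair_coords_unique[OF uv] by blast+
  moreover have "a = b" if "of_int a + p = of_int b + q" "p \<in> {0..<1}" "q \<in> {0..<1}" for a b :: int and p q :: real
  proof -
    have "\<lfloor>of_int a + p\<rfloor> = a" "\<lfloor>of_int b + q\<rfloor> = b" using that(2,3) by (auto simp: floor_eq_iff)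
    then show ?thesis using that(1) by simp
  qed
  ultimately have "m = m'" "n = n'" using st by blast+
  then show ?thesis using w_eq by simp
qed

text \<open>The translates of \<open>E\<close> by the vectors in \<open>L\<close> are pairwise disjoint and cover the plane up to a set of
  measure zero.\<close>

definition tiles :: "(real^2) set \<Rightarrow> (real^2) set \<Rightarrow> bool"
  where "tiles L E \<longleftrightarrow> E \<in> sets lebesgue \<and>
    (\<forall>w\<in>L. \<forall>w'\<in>L. \<forall>x. x - w \<in> E \<longrightarrow> x - w' \<in> E \<longrightarrow> w = w') \<and>
    negligible {x. \<forall>w\<in>L. x - w \<notin> E}"

lemma emeasure_translation: "emeasure lebesgue ((+) a ` S) = emeasure lebesgue (S :: (real^2) set)"
  using emeasure_lebesgue_affine[of 1 a S] by (simp add: ac_simps cong: image_cong_simp)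

lemma mem_translation: "x \<in> (+) w ` E \<longleftrightarrow> x - w \<in> E" for x w :: "'a::ab_group_add"
  by (auto simp: image_iff intro: bexI[of _ "x - w"])

text \<open>The bijection \<open>\<sigma>\<close> allows the translates to be enumerated by \<open>w\<close> as well as by \<open>- w\<close>.\<close>

lemma emeasure_split_tiles:
  assumes L: "countable L" and \<sigma>: "bij_betw \<sigma> L L" and E: "tiles L E" and A: "A \<in> sets lebesgue"
  shows "emeasure lebesgue A = (\<integral>\<^sup>+w. emeasure lebesgue (A \<inter> (+) (\<sigma> w) ` E) \<partial>count_space L)"
proof -
  have \<sigma>L: "\<sigma> w \<in> L" if "w \<in> L" for w using \<sigma> that by (auto simp: bij_betw_def)
  have meas: "A \<inter> (+) (\<sigma> w) ` E \<in> sets lebesgue" for w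
    using A E by (auto simp: tiles_def intro: lebesgue_sets_translation)
  have disj: "disjoint_family_on (\<lambda>w. A \<inter> (+) (\<sigma> w) ` E) L"
  proof (unfold disjoint_family_on_def, intro ballI impI)
    fix w w' assume w: "w \<in> L" "w' \<in> L" "w \<noteq> w'"
    then have "\<sigma> w \<noteq> \<sigma> w'" using \<sigma> by (auto simp: bij_betw_def inj_on_def)
    then show "A \<inter> (+) (\<sigma> w) ` E \<inter> (A \<inter> (+) (\<sigma> w') ` E) = {}"
      using E \<sigma>L[OF w(1)] \<sigma>L[OF w(2)] unfolding tiles_def disjoint_iff Int_iff mem_translation by blast
  qed
  let ?N = "{x. \<forall>w\<in>L. x - w \<notin> E}"
  have N: "?N \<in> null_sets lebesgue" using E by (simp add: tiles_def negligible_iff_null_sets)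
  have "A - (\<Union>w\<in>L. A \<inter> (+) (\<sigma> w) ` E) \<subseteq> ?N"
  proof
    fix x assume x: "x \<in> A - (\<Union>w\<in>L. A \<inter> (+) (\<sigma> w) ` E)"
    have "x - w \<notin> E" if "w \<in> L" for w
    proof -
      have "w \<in> \<sigma> ` L" using bij_betw_imp_surj_on[OF \<sigma>] that by simp
      then obtain w0 where w0: "w0 \<in> L" "w = \<sigma> w0" by blast
      have "x \<in> A" "x \<notin> A \<inter> (+) (\<sigma> w0) ` E" using x w0(1) by blast+
      then show ?thesis unfolding w0(2) Int_iff mem_translation by blast
    qed
    then show "x \<in> ?N" by simp
  qed
  then have "A - (\<Union>w\<in>L. A \<inter> (+) (\<sigma> w) ` E) \<in> null_sets lebesgue"
    using N null_sets_completion_subset by blast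
  moreover have un: "(\<Union>w\<in>L. A \<inter> (+) (\<sigma> w) ` E) \<in> sets lebesgue"
    using L meas by (intro sets.countable_UN') auto
  ultimately have "emeasure lebesgue ((\<Union>w\<in>L. A \<inter> (+) (\<sigma> w) ` E) \<union> (A - (\<Union>w\<in>L. A \<inter> (+) (\<sigma> w) ` E)))
     = emeasure lebesgue (\<Union>w\<in>L. A \<inter> (+) (\<sigma> w) ` E)"
    by (intro emeasure_Un_null_set)
  moreover have "(\<Union>w\<in>L. A \<inter> (+) (\<sigma> w) ` E) \<union> (A - (\<Union>w\<in>L. A \<inter> (+) (\<sigma> w) ` E)) = A" by blast
  ultimately show ?thesis using emeasure_UN_countable[OF meas L disj] by simp
qed

text \<open>Any two fundamental domains contain equally much of an invariant set: cut each of them by the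
  translates of the other and compare piece by piece.\<close>

lemma emeasure_tiles_eq:
  assumes L: "countable L" "\<And>w. w \<in> L \<Longrightarrow> - w \<in> L"
    and E: "tiles L E" "tiles L E'"
    and A: "A \<in> sets lebesgue" "\<And>w. w \<in> L \<Longrightarrow> (+) w ` A = A"
  shows "emeasure lebesgue (A \<inter> E) = emeasure lebesgue (A \<inter> E')"
proof -
  have meas: "A \<inter> E \<in> sets lebesgue" "A \<inter> E' \<in> sets lebesgue"
    using A E by (auto simp: tiles_def)
  have bij: "bij_betw uminus L L" "bij_betw id L L"
    using L(2) by (auto intro!: bij_betwI[of _ _ _ uminus])
  have "emeasure lebesgue (A \<inter> E) = (\<integral>\<^sup>+w. emeasure lebesgue (A \<inter> E \<inter> (+) w ` E') \<partial>count_space L)"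
    using emeasure_split_tiles[OF L(1) bij(2) E(2) meas(1)] by simp
  also have "\<dots> = (\<integral>\<^sup>+w. emeasure lebesgue (A \<inter> E' \<inter> (+) (- w) ` E) \<partial>count_space L)"
  proof (rule nn_integral_cong)
    fix w assume "w \<in> space (count_space L)"
    then have w: "w \<in> L" by simp
    have "(+) w ` (A \<inter> E' \<inter> (+) (- w) ` E) = (+) w ` A \<inter> (+) w ` E' \<inter> (+) w ` (+) (- w) ` E"
      by (simp add: image_Int)
    also have "(+) w ` (+) (- w) ` E = E" by (simp add: image_image)
    finally have "(+) w ` (A \<inter> E' \<inter> (+) (- w) ` E) = A \<inter> E \<inter> (+) w ` E'"
      unfolding A(2)[OF w] by blast
    then show "emeasure lebesgue (A \<inter> E \<inter> (+) w ` E') = emeasure lebesgue (A \<inter> E' \<inter> (+) (- w) ` E)"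
      by (metis emeasure_translation)
  qed
  also have "\<dots> = emeasure lebesgue (A \<inter> E')"
    using emeasure_split_tiles[OF L(1) bij(1) E(1) meas(2)] by simp
  finally show ?thesis .
qed

lemma tiles_fundamental_region:
  assumes "u \<noteq> v" "independent {u, v}"
  shows "tiles (lattice_gen u v) (fundamental_region u v)"
proof -
  have "{x. \<forall>w\<in>lattice_gen u v. x - w \<notin> fundamental_region u v} = {}"
    using lattice_translate_into_region[OF assms] by blast
  then have "negligible {x. \<forall>w\<in>lattice_gen u v. x - w \<notin> fundamental_region u v}"
    by (simp only: negligible_empty)
  then show ?thesis
    unfolding tiles_def
    using lattice_translate_into_region_unique[OF assms] fmeasurableD[OF fundamental_region_measurable]
    by blast
qed

text \<open>The lower left corner of the bounding box of \<open>T\<close>. It serves to select one set from every orbit of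
  bounded sets under the lattice, since it moves along with \<open>T\<close> under translations.\<close>

definition anchor :: "(real^2) set \<Rightarrow> real^2"
  where "anchor T = (\<chi> i. Inf ((\<lambda>x. x $ i) ` T))"

lemma anchor_translation:
  assumes "bounded T" "T \<noteq> {}"
  shows "anchor ((+) w ` T) = w + anchor T"
proof -
  have "Inf ((\<lambda>x. x $ i) ` ((+) w ` T)) = w $ i + Inf ((\<lambda>x. x $ i) ` T)" for i
  proof -
    obtain B where "\<And>x. x \<in> T \<Longrightarrow> norm x \<le> B" using assms(1) by (auto simp: bounded_iff)
    then have B: "- B \<le> x $ i" if "x \<in> T" for x
      using that component_le_norm_cart[of x i] by (smt (verit))
    have bdd: "bdd_below ((\<lambda>x. x $ i) ` T)"
      using B by (auto intro!: bdd_belowI2)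
    have "Inf ((\<lambda>x. w $ i + x $ i) ` T) = w $ i + Inf ((\<lambda>x. x $ i) ` T)"
      by (rule Inf_add_eq[OF bdd assms(2)])
    then show ?thesis by (simp add: image_image)
  qed
  then show ?thesis by (simp add: anchor_def vec_eq_iff)
qed

section \<open>Faces of the contact graph of a packing\<close>

lemma packing_radius_pos: "disk_packing P \<Longrightarrow> d \<in> P \<Longrightarrow> 0 < radius d"
  by (simp add: disk_packing_def)

lemma disjoint_balls_imp_dist_ge:
  fixes p q :: "'a::euclidean_space"
  assumes "ball p x \<inter> ball q y = {}" and pos: "0 < x" "0 < y"
  shows "dist p q \<ge> x + y"
proof (rule ccontr)
  assume "\<not> dist p q \<ge> x + y"
  then have lt: "dist p q < x + y" by simp
  define t where "t = x / (x + y)"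
  have t: "0 < t" "t < 1" "1 - t = y / (x + y)" using pos by (auto simp: t_def field_simps)
  define m where "m = p + t *\<^sub>R (q - p)"
  have "dist p m = t * dist p q" using t by (simp add: m_def dist_norm norm_minus_commute)
  also have "\<dots> < t * (x + y)" using lt t by simp
  also have "\<dots> = x" using pos by (simp add: t_def)
  finally have 1: "m \<in> ball p x" by simp
  have "q - m = (1 - t) *\<^sub>R (q - p)" by (simp add: m_def algebra_simps)
  then have "dist q m = (1 - t) * dist p q" using t(1,2) by (simp add: dist_norm norm_minus_commute)
  also have "\<dots> < (1 - t) * (x + y)" using lt t(2) by (intro mult_strict_left_mono) auto
  also have "\<dots> = y" using pos by (simp add: t(3))
  finally have "m \<in> ball q y" by simp
  then show False using 1 assms(1) by blast
qed

lemma packing_dist_ge: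
  assumes "disk_packing P" "d \<in> P" "e \<in> P" "d \<noteq> e"
  shows "dist (center d) (center e) \<ge> radius d + radius e"
proof -
  have "ball (center d) (radius d) \<inter> ball (center e) (radius e) = {}"
    using assms unfolding disk_packing_def disjoint_family_on_def disk_region_def by auto
  then show ?thesis using assms by (intro disjoint_balls_imp_dist_ge) (auto simp: disk_packing_def)
qed

text \<open>At a common point, the unit vectors towards the three centers would have pairwise inner products at
  most \<open>-1\<close>, and their sum would have negative squared norm.\<close>

lemma three_balls_common_point:
  fixes a b d x :: "'a::real_inner"
  assumes pos: "0 < ra" "0 < rb" "0 < rd"
    and x: "dist a x \<le> ra" "dist b x \<le> rb" "dist d x \<le> rd"
    and far: "ra + rb \<le> dist a b" "rb + rd \<le> dist b d" "rd + ra \<le> dist d a"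
  shows False
proof -
  have eq: "norm (a - x) = ra" "norm (b - x) = rb" "norm (d - x) = rd"
    using x far dist_triangle[of a b x] dist_triangle[of b d x] dist_triangle[of d a x]
    by (auto simp: dist_norm norm_minus_commute)
  have inner_le: "inner v w \<le> - (r * s)" if "norm v = r" "norm w = s" "r + s \<le> norm (v - w)" "0 < r" "0 < s"
    for v w :: 'a and r s
  proof -
    have "(r + s)^2 \<le> (norm (v - w))^2" using that by (intro power_mono) auto
    also have "\<dots> = r^2 + s^2 - 2 * inner v w"
      using that(1,2) by (simp add: power2_norm_eq_inner inner_diff_left inner_diff_right inner_commute flip: that(1,2))
    finally show ?thesis by (simp add: power2_eq_square algebra_simps)
  qed
  define u v w where "u = (1/ra) *\<^sub>R (a - x)" and "v = (1/rb) *\<^sub>R (b - x)" and "w = (1/rd) *\<^sub>R (d - x)"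
  have i: "inner (a - x) (b - x) \<le> - (ra * rb)" "inner (b - x) (d - x) \<le> - (rb * rd)"
    "inner (d - x) (a - x) \<le> - (rd * ra)"
    using far by (intro inner_le eq pos; simp add: dist_norm)+
  have "norm u = 1" "norm v = 1" "norm w = 1"
    using pos by (simp_all add: u_def v_def w_def eq)
  then have sq: "inner u u = 1" "inner v v = 1" "inner w w = 1" by (simp_all add: norm_eq_1)
  have "inner u v = inner (a - x) (b - x) / (ra * rb)" "inner v w = inner (b - x) (d - x) / (rb * rd)"
    "inner w u = inner (d - x) (a - x) / (rd * ra)"
    by (simp_all add: u_def v_def w_def)
  then have i': "inner u v \<le> -1" "inner v w \<le> -1" "inner w u \<le> -1"
    using i pos by (simp_all add: pos_divide_le_eq)
  have "0 \<le> inner (u + v + w) (u + v + w)" by simp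
  also have "\<dots> = 3 + 2 * inner u v + 2 * inner v w + 2 * inner w u"
    using inner_commute[of u v] inner_commute[of v w] inner_commute[of w u]
    by (simp add: inner_add_left inner_add_right sq)
  also have "\<dots> < 0" using i' by linarith
  finally show False by simp
qed

lemma edge_meets_only_endpoint_disks:
  assumes P: "disk_packing P" and abd: "a \<in> P" "b \<in> P" "d \<in> P" and "tangent a b"
    and x: "x \<in> closed_segment (center a) (center b)" "x \<in> disk_region d"
  shows "d = a \<or> d = b"
proof (rule ccontr)
  assume ne: "\<not> (d = a \<or> d = b)"
  have pos: "0 < radius a" "0 < radius b" "0 < radius d" using P abd by (auto simp: packing_radius_pos)
  have ab: "dist (center a) (center b) = radius a + radius b" using \<open>tangent a b\<close> by (simp add: tangent_def)
  have far: "radius b + radius d \<le> dist (center b) (center d)" "radius d + radius a \<le> dist (center d) (center a)"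
    using packing_dist_ge[OF P abd(2,3)] packing_dist_ge[OF P abd(3,1)] ne by auto
  have sum: "dist (center a) x + dist x (center b) = radius a + radius b"
    using x(1) ab by (metis between between_mem_segment)
  have xd: "dist (center d) x \<le> radius d" using x(2) by (simp add: disk_region_def)
  have "dist (center a) x \<ge> radius a" "dist (center b) x \<ge> radius b"
    using far xd dist_triangle[of "center d" "center a" x] dist_triangle[of "center b" "center d" x]
    by (auto simp: dist_commute)
  then have "dist (center a) x \<le> radius a" "dist (center b) x \<le> radius b"
    using sum by (auto simp: dist_commute)
  then show False using three_balls_common_point[OF pos _ _ xd _ far] ab by simp
qed

text \<open>Three mutually tangent disks whose centers span a face of the contact graph.\<close>

definition face_triple :: "disk set \<Rightarrow> disk \<Rightarrow> disk \<Rightarrow> disk \<Rightarrow> bool"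
  where "face_triple P a b c \<longleftrightarrow> a \<in> P \<and> b \<in> P \<and> c \<in> P \<and>
    tangent a b \<and> tangent b c \<and> tangent c a \<and>
    interior (convex hull {center a, center b, center c}) \<in> faces P"

lemma face_obtain_triple:
  assumes "triangulated P" "T \<in> faces P"
  obtains a b c where "face_triple P a b c" "T = interior (convex hull {center a, center b, center c})"
proof -
  obtain a b c where "a \<in> P" "b \<in> P" "c \<in> P" "tangent a b" "tangent b c" "tangent c a"
    and T: "T = interior (convex hull {center a, center b, center c})"
    using assms unfolding triangulated_def by blast
  then have "face_triple P a b c" using assms(2) by (simp add: face_triple_def)
  then show thesis using T by (rule that)
qed

lemma edge_subset_contact_graph:
  assumes "a \<in> P" "b \<in> P" "tangent a b"
  shows "closed_segment (center a) (center b) \<subseteq> contact_graph P"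
proof -
  have "closed_segment (center a) (center b) \<in>
      {closed_segment (center d) (center e) | d e. d \<in> P \<and> e \<in> P \<and> tangent d e}"
    using assms by blast
  then show ?thesis unfolding contact_graph_def by (intro le_supI2 Union_upper)
qed

lemma face_disjoint_contact_graph: "T \<in> faces P \<Longrightarrow> T \<inter> contact_graph P = {}"
  using in_components_subset[of T "- contact_graph P"] by (auto simp: faces_def)

lemma edge_subset_disks:
  assumes "tangent a b" "x \<in> closed_segment (center a) (center b)"
  shows "x \<in> disk_region a \<or> x \<in> disk_region b"
  using segment_covered_by_disks[of "center a" "center b" "radius a" "radius b" x] assms
  by (simp add: tangent_def disk_region_def dist_commute)

lemma face_triple_boundary:
  assumes f: "face_triple P a b c"
    and x: "x \<in> convex hull {center a, center b, center c}"
      "x \<notin> interior (convex hull {center a, center b, center c})"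
  obtains d e where "d \<in> {a, b, c}" "e \<in> {a, b, c}" "tangent d e"
    "x \<in> closed_segment (center d) (center e)"
proof -
  have "x \<in> frontier (convex hull {center a, center b, center c})"
    using x closure_subset by (auto simp: frontier_def)
  then have "x \<in> closed_segment (center a) (center b) \<or> x \<in> closed_segment (center b) (center c) \<or>
      x \<in> closed_segment (center c) (center a)"
    by (subst (asm) frontier_of_triangle) auto
  then show thesis using f that unfolding face_triple_def by blast
qed

lemma face_triple_contact_graph_point:
  assumes f: "face_triple P a b c"
    and x: "x \<in> convex hull {center a, center b, center c}" "x \<in> contact_graph P"
  obtains d e where "d \<in> {a, b, c}" "e \<in> {a, b, c}" "tangent d e"
    "x \<in> closed_segment (center d) (center e)"
proof -
  have "x \<notin> interior (convex hull {center a, center b, center c})"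
    using f x(2) face_disjoint_contact_graph unfolding face_triple_def by blast
  then show thesis using face_triple_boundary[OF f x(1)] that by blast
qed

lemma face_triple_disk_at_point:
  assumes P: "disk_packing P" and f: "face_triple P a b c"
    and x: "x \<in> convex hull {center a, center b, center c}" "x \<in> contact_graph P"
    and d: "d \<in> P" "x \<in> disk_region d"
  shows "d \<in> {a, b, c}"
proof -
  obtain d' e' where de: "d' \<in> {a, b, c}" "e' \<in> {a, b, c}" "tangent d' e'"
    "x \<in> closed_segment (center d') (center e')"
    using face_triple_contact_graph_point[OF f x] .
  then have "d' \<in> P" "e' \<in> P" using f by (auto simp: face_triple_def)
  then have "d = d' \<or> d = e'" using edge_meets_only_endpoint_disks[OF P _ _ d(1) de(3,4) d(2)] by blast
  then show ?thesis using de by blast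
qed

lemma closure_face_triple:
  assumes "face_triple P a b c"
  shows "closure (interior (convex hull {center a, center b, center c})) = convex hull {center a, center b, center c}"
proof -
  have "interior (convex hull {center a, center b, center c}) \<noteq> {}"
    using assms in_components_nonempty by (auto simp: face_triple_def faces_def)
  then have "closure (interior (convex hull {center a, center b, center c})) = closure (convex hull {center a, center b, center c})"
    by (intro convex_closure_interior) auto
  also have "\<dots> = convex hull {center a, center b, center c}"
    by (intro closure_closed compact_imp_closed compact_convex_hull finite_imp_compact) auto
  finally show ?thesis .
qed

lemma center_in_contact_graph: "d \<in> P \<Longrightarrow> center d \<in> contact_graph P"
  by (auto simp: contact_graph_def)

text \<open>Two closed faces that meet have a common vertex. At a point of the contact graph this holds because
  a disk of one face that contains the point is a vertex of both; at any other point the faces coincide.\<close>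

lemma face_triples_common_vertex:
  assumes P: "disk_packing P" and f: "face_triple P a b c" "face_triple P a' b' c'"
    and x: "x \<in> convex hull {center a, center b, center c}" "x \<in> convex hull {center a', center b', center c'}"
  shows "{a, b, c} \<inter> {a', b', c'} \<noteq> {}"
proof (cases "x \<in> contact_graph P")
  case True
  obtain d e where "d \<in> {a, b, c}" "e \<in> {a, b, c}" and de: "tangent d e"
    "x \<in> closed_segment (center d) (center e)"
    using face_triple_contact_graph_point[OF f(1) x(1) True] .
  then obtain d where d: "d \<in> {a, b, c}" "x \<in> disk_region d"
    using edge_subset_disks[OF de] by blast
  then have "d \<in> {a', b', c'}"
    using f(1) by (intro face_triple_disk_at_point[OF P f(2) x(2) True]) (auto simp: face_triple_def)
  then show ?thesis using d by blast
next
  case False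
  have int: "x \<in> interior (convex hull {center a, center b, center c})" if t: "face_triple P a b c"
    "x \<in> convex hull {center a, center b, center c}" for a b c
  proof (rule ccontr)
    assume "x \<notin> interior (convex hull {center a, center b, center c})"
    with t obtain d e where "d \<in> {a, b, c}" "e \<in> {a, b, c}" and de: "tangent d e"
      "x \<in> closed_segment (center d) (center e)"
      by (rule face_triple_boundary)
    then have "x \<in> contact_graph P"
      using edge_subset_contact_graph[of d P e] t(1) by (auto simp: face_triple_def)
    then show False using False by simp
  qed
  \<comment> \<open>Both faces are the component of the complement of the contact graph that contains \<open>x\<close>.\<close>
  have "interior (convex hull {center a, center b, center c}) = interior (convex hull {center a', center b', center c'})"
    using int[OF f(1) x(1)] int[OF f(2) x(2)] f components_nonoverlap
    unfolding face_triple_def faces_def by blast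
  then have hull: "convex hull {center a, center b, center c} = convex hull {center a', center b', center c'}"
    by (subst closure_face_triple[OF f(1), symmetric], subst closure_face_triple[OF f(2), symmetric])
      (rule arg_cong[of _ _ closure])
  have a: "a \<in> P" using f(1) by (simp add: face_triple_def)
  have "center a \<in> convex hull {center a, center b, center c}" by (rule hull_inc) simp
  moreover have "center a \<in> disk_region a" using packing_radius_pos[OF P a] by (simp add: disk_region_def)
  ultimately have "a \<in> {a', b', c'}"
    using face_triple_disk_at_point[OF P f(2) _ center_in_contact_graph[OF a] a] by (simp only: hull)
  then show ?thesis by blast
qed

section \<open>Measure in triangulated periodic packings\<close>

text \<open>A triangulated doubly periodic packing. Within the locale, \<open>L\<close> is the lattice of periods, \<open>U\<close> the
  set covered by the disks and \<open>G\<close> the contact graph.\<close>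

locale compact_packing =
  fixes P :: "disk set" and u v :: "real^2"
  assumes packing: "disk_packing P"
    and periodic: "doubly_periodic P u v"
    and triangulated: "triangulated P"
begin

abbreviation "L \<equiv> lattice_gen u v"
abbreviation "U \<equiv> \<Union>d\<in>P. disk_region d"
abbreviation "G \<equiv> contact_graph P"

lemma basis: "u \<noteq> v" "independent {u, v}"
  using periodic by (auto simp: doubly_periodic_def)

lemma translate_disk_in_packing:
  assumes "d \<in> P" "w \<in> L" shows "translate_disk w d \<in> P"
  using assms periodic unfolding doubly_periodic_def by blast

lemma lattice_invariantI:
  assumes "\<And>w. w \<in> L \<Longrightarrow> (+) w ` A \<subseteq> A" and w: "w \<in> L"
  shows "(+) w ` A = A"
proof
  show "A \<subseteq> (+) w ` A"
  proof
    fix x assume "x \<in> A"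
    then have "- w + x \<in> A" using assms(1)[OF lattice_gen_minus[OF w]] by blast
    then show "x \<in> (+) w ` A" by (intro image_eqI[of _ _ "- w + x"]) simp_all
  qed
qed (use assms in blast)

lemma disk_region_translate: "disk_region (translate_disk w d) = (+) w ` disk_region d"
  by (simp add: disk_region_def translate_disk_def cball_translation add.commute)

lemma tangent_translate: "tangent (translate_disk w d) (translate_disk w e) \<longleftrightarrow> tangent d e"
  by (simp add: tangent_def translate_disk_def)

lemma covered_set_invariant:
  assumes "w \<in> L" shows "(+) w ` U = U"
proof (rule lattice_invariantI[OF _ assms])
  fix w assume w: "w \<in> L"
  show "(+) w ` U \<subseteq> U"
  proof
    fix x assume "x \<in> (+) w ` U"
    then obtain d where "d \<in> P" "x \<in> (+) w ` disk_region d" by blast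
    then have "translate_disk w d \<in> P" "x \<in> disk_region (translate_disk w d)"
      using translate_disk_in_packing[OF _ w] by (simp_all only: disk_region_translate)
    then show "x \<in> U" by blast
  qed
qed

lemma contact_graph_invariant:
  assumes "w \<in> L" shows "(+) w ` G = G"
proof (rule lattice_invariantI[OF _ assms])
  fix w assume w: "w \<in> L"
  show "(+) w ` G \<subseteq> G"
  proof
    fix x assume "x \<in> (+) w ` G"
    then obtain y where y: "y \<in> G" "x = w + y" by blast
    from y(1) consider d where "d \<in> P" "y = center d"
      | d e where "d \<in> P" "e \<in> P" "tangent d e" "y \<in> closed_segment (center d) (center e)"
      unfolding contact_graph_def by blast
    then show "x \<in> G"
    proof cases
      case 1
      then show ?thesis using center_in_contact_graph[OF translate_disk_in_packing[OF 1(1) w]]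
        by (simp add: translate_disk_def y(2) add.commute)
    next
      case 2
      have "x \<in> closed_segment (center (translate_disk w d)) (center (translate_disk w e))"
        using 2(4) by (simp add: translate_disk_def y(2) add.commute[of _ w])
      then show ?thesis
        using edge_subset_contact_graph[OF translate_disk_in_packing[OF 2(1) w] translate_disk_in_packing[OF 2(2) w]] 2(3)
        by (auto simp: tangent_translate)
    qed
  qed
qed

lemma face_translate:
  assumes T: "T \<in> faces P" and w: "w \<in> L"
  shows "(+) w ` T \<in> faces P"
proof -
  have compl: "(+) w ` (- G) = - G" if "w \<in> L" for w
    using contact_graph_invariant[OF that] by (simp add: bij_image_Compl_eq)
  have T': "T \<noteq> {}" "T \<subseteq> - G" "connected T"
    and max: "\<And>D. \<lbrakk>D \<noteq> {}; T \<subseteq> D; D \<subseteq> - G; connected D\<rbrakk> \<Longrightarrow> D = T"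
    using T unfolding faces_def in_components_maximal by blast+
  have "D = (+) w ` T" if D: "D \<noteq> {}" "(+) w ` T \<subseteq> D" "D \<subseteq> - G" "connected D" for D
  proof -
    have "(+) (- w) ` D = T"
    proof (rule max)
      show "(+) (- w) ` D \<noteq> {}" using D(1) by simp
      show "T \<subseteq> (+) (- w) ` D"
      proof
        fix x assume "x \<in> T"
        then have "w + x \<in> D" using D(2) by blast
        then show "x \<in> (+) (- w) ` D" by (intro image_eqI[of _ _ "w + x"]) simp_all
      qed
      show "(+) (- w) ` D \<subseteq> - G" using D(3) compl[OF lattice_gen_minus[OF w]] by blast
      show "connected ((+) (- w) ` D)" using D(4) by (intro connected_continuous_image continuous_intros)
    qed
    then have "(+) w ` (+) (- w) ` D = (+) w ` T" by simp
    then show ?thesis by (simp add: image_image)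
  qed
  moreover have "(+) w ` T \<noteq> {}" using T'(1) by simp
  moreover have "(+) w ` T \<subseteq> - G" using T'(2) compl[OF w] by blast
  moreover have "connected ((+) w ` T)" using T'(3) by (intro connected_continuous_image continuous_intros)
  ultimately show ?thesis unfolding faces_def in_components_maximal by blast
qed

lemma countable_packing: "countable P"
proof -
  let ?I = "\<lambda>d. interior (disk_region d)"
  have disj: "?I d \<inter> ?I e = {}" if "d \<in> P" "e \<in> P" "d \<noteq> e" for d e
    using packing that unfolding disk_packing_def disjoint_family_on_def by blast
  have ne: "?I d \<noteq> {}" if "d \<in> P" for d
    using packing_radius_pos[OF packing that] by (simp add: disk_region_def)
  have "inj_on ?I P"
    by (rule inj_onI) (metis disj ne Int_absorb)
  moreover have "countable (?I ` P)"
  proof (rule countable_disjoint_open_subsets)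
    show "disjoint (?I ` P)"
      unfolding pairwise_def disjnt_def using disj by blast
  qed auto
  ultimately show ?thesis by (rule countable_image_inj_on[rotated])
qed

lemma negligible_contact_graph: "negligible G"
proof -
  have seg: "negligible (closed_segment a b)" for a b :: "real^2"
    by (simp add: negligible_convex_interior interior_closed_segment_ge2)
  have "negligible (\<Union>((\<lambda>(d, e). closed_segment (center d) (center e)) ` (P \<times> P)))"
    using countable_packing seg by (intro negligible_countable_Union) auto
  moreover have "G \<subseteq> \<Union>((\<lambda>(d, e). closed_segment (center d) (center e)) ` (P \<times> P))"
  proof
    fix x assume "x \<in> G"
    then obtain d e where "d \<in> P" "e \<in> P" "x \<in> closed_segment (center d) (center e)"
      unfolding contact_graph_def by auto
    then show "x \<in> \<Union>((\<lambda>(d, e). closed_segment (center d) (center e)) ` (P \<times> P))" by blast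
  qed
  ultimately show ?thesis by (rule negligible_subset)
qed

lemma face_open_bounded:
  assumes "T \<in> faces P" shows "open T" "bounded T" "T \<noteq> {}"
proof -
  obtain a b c where T: "T = interior (convex hull {center a, center b, center c})"
    using face_obtain_triple[OF triangulated assms] .
  show "open T" by (simp add: T)
  have "bounded (convex hull {center a, center b, center c})"
    by (intro finite_imp_bounded_convex_hull) auto
  then show "bounded T" unfolding T by (rule bounded_interior)
  show "T \<noteq> {}" using assms in_components_nonempty by (auto simp: faces_def)
qed

lemma faces_disjoint: "T \<in> faces P \<Longrightarrow> T' \<in> faces P \<Longrightarrow> T \<inter> T' \<noteq> {} \<Longrightarrow> T = T'"
  using components_nonoverlap unfolding faces_def by blast

lemma countable_faces: "countable (faces P)"
proof (rule countable_disjoint_open_subsets)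
  show "disjoint (faces P)" using faces_disjoint unfolding pairwise_def disjnt_def by blast
qed (use face_open_bounded in blast)

text \<open>One face from every orbit under the lattice.\<close>

definition face_representatives :: "(real^2) set set"
  where "face_representatives = {T \<in> faces P. anchor T \<in> fundamental_region u v}"

lemma tiles_face_representatives: "tiles L (\<Union>face_representatives)"
  unfolding tiles_def
proof (intro conjI ballI allI impI)
  have "open (\<Union>face_representatives)"
    using face_open_bounded(1) by (auto simp: face_representatives_def)
  then show "\<Union>face_representatives \<in> sets lebesgue" by (intro sets_completionI_sets) simp
next
  fix w w' x assume w: "w \<in> L" "w' \<in> L"
    and "x - w \<in> \<Union>face_representatives" "x - w' \<in> \<Union>face_representatives"
  then obtain T T' where T: "T \<in> face_representatives" "x - w \<in> T"
    and T': "T' \<in> face_representatives" "x - w' \<in> T'" by blast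
  have f: "T \<in> faces P" "T' \<in> faces P" using T T' by (auto simp: face_representatives_def)
  have "x \<in> (+) w ` T" "x \<in> (+) w' ` T'" using T(2) T'(2) by (simp_all only: mem_translation)
  then have "(+) w ` T = (+) w' ` T'"
    using faces_disjoint[OF face_translate[OF f(1) w(1)] face_translate[OF f(2) w(2)]] by blast
  then have eq: "w + anchor T = w' + anchor T'"
    using anchor_translation[OF face_open_bounded(2,3)[OF f(1)]] anchor_translation[OF face_open_bounded(2,3)[OF f(2)]]
    by metis
  have "(w + anchor T) - w' = anchor T'" unfolding eq by simp
  then have "(w + anchor T) - w' \<in> fundamental_region u v" using T'(1) by (simp add: face_representatives_def)
  moreover have "(w + anchor T) - w \<in> fundamental_region u v" using T(1) by (simp add: face_representatives_def)
  ultimately show "w = w'" using lattice_translate_into_region_unique[OF basis w] by blast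
next
  have "{x. \<forall>w\<in>L. x - w \<notin> \<Union>face_representatives} \<subseteq> G"
  proof (rule subsetI, rule ccontr)
    fix x assume x: "x \<in> {x. \<forall>w\<in>L. x - w \<notin> \<Union>face_representatives}" and "x \<notin> G"
    then obtain T where T: "T \<in> faces P" "x \<in> T"
      unfolding faces_def using Union_components[of "- G"] by blast
    obtain w where w: "w \<in> L" "anchor T - w \<in> fundamental_region u v"
      using lattice_translate_into_region[OF basis] .
    have "anchor ((+) (- w) ` T) = anchor T - w"
      unfolding anchor_translation[OF face_open_bounded(2,3)[OF T(1)]] by simp
    then have "(+) (- w) ` T \<in> face_representatives"
      using w(2) face_translate[OF T(1) lattice_gen_minus[OF w(1)]] by (simp add: face_representatives_def)
    moreover have "x - w \<in> (+) (- w) ` T" using T(2) by (intro image_eqI[of _ _ x]) simp_all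
    ultimately show False using x w(1) by blast
  qed
  then show "negligible {x. \<forall>w\<in>L. x - w \<notin> \<Union>face_representatives}"
    using negligible_contact_graph negligible_subset by blast
qed

lemma covered_set_measurable: "U \<in> sets lebesgue"
  using countable_packing by (intro sets.countable_UN') (auto simp: disk_region_def)

text \<open>The fundamental parallelogram can be replaced by a union of entire faces.\<close>

lemma region_measures_eq:
  "emeasure lebesgue (U \<inter> fundamental_region u v) = emeasure lebesgue (U \<inter> \<Union>face_representatives)"
  "emeasure lebesgue (fundamental_region u v) = emeasure lebesgue (\<Union>face_representatives)"
proof -
  note * = emeasure_tiles_eq[OF countable_lattice_gen lattice_gen_minus
      tiles_fundamental_region[OF basis] tiles_face_representatives]
  show "emeasure lebesgue (U \<inter> fundamental_region u v) = emeasure lebesgue (U \<inter> \<Union>face_representatives)"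
    by (rule *[OF _ covered_set_measurable covered_set_invariant])
  show "emeasure lebesgue (fundamental_region u v) = emeasure lebesgue (\<Union>face_representatives)"
    using *[of UNIV] by simp
qed

lemma face_density:
  assumes f: "face_triple P a b c"
  defines "T \<equiv> interior (convex hull {center a, center b, center c})"
  shows "hex_density * measure lebesgue T \<le> measure lebesgue (U \<inter> T)"
    and "\<not> (radius a = radius b \<and> radius b = radius c) \<Longrightarrow>
      hex_density * measure lebesgue T < measure lebesgue (U \<inter> T)"
proof -
  have abc: "a \<in> P" "b \<in> P" "c \<in> P" "tangent a b" "tangent b c" "tangent c a"
    using f by (auto simp: face_triple_def)
  have "cball (center a) (radius a) \<union> cball (center b) (radius b) \<union> cball (center c) (radius c) \<subseteq> U"
    using abc(1-3) by (auto simp: disk_region_def)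
  note * = tangent_disks_density[OF packing_radius_pos[OF packing abc(1)] packing_radius_pos[OF packing abc(2)]
      packing_radius_pos[OF packing abc(3)] _ _ _ covered_set_measurable this]
  show "hex_density * measure lebesgue T \<le> measure lebesgue (U \<inter> T)"
    unfolding T_def using abc(4-6) by (intro *(1)) (simp_all add: tangent_def)
  show "hex_density * measure lebesgue T < measure lebesgue (U \<inter> T)"
    if "\<not> (radius a = radius b \<and> radius b = radius c)"
    unfolding T_def using abc(4-6) that by (intro *(2)) (simp_all add: tangent_def)
qed

section \<open>A face with unequal radii\<close>

lemma radii_finite: "finite (radius ` P)"
proof (rule finite_subset)
  show "finite (radius ` {d\<in>P. center d \<in> fundamental_region u v})"
    using periodic by (intro finite_imageI) (simp add: doubly_periodic_def)
  show "radius ` P \<subseteq> radius ` {d\<in>P. center d \<in> fundamental_region u v}"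
  proof
    fix r assume "r \<in> radius ` P"
    then obtain d where d: "d \<in> P" "r = radius d" by blast
    obtain w where w: "w \<in> L" "center d - w \<in> fundamental_region u v"
      using lattice_translate_into_region[OF basis] .
    have "translate_disk (- w) d \<in> P" using translate_disk_in_packing[OF d(1) lattice_gen_minus[OF w(1)]] .
    then show "r \<in> radius ` {d\<in>P. center d \<in> fundamental_region u v}"
      using w(2) d(2) by (intro image_eqI[of _ _ "translate_disk (- w) d"]) (simp_all add: translate_disk_def)
  qed
qed

lemma finitely_many_disks_near: "finite {d\<in>P. dist x (center d) \<le> M}"
proof -
  let ?Q = "{d\<in>P. dist x (center d) \<le> M}"
  obtain r where r: "r > 0" "\<And>d. d \<in> P \<Longrightarrow> r \<le> radius d"
  proof (cases "P = {}")
    case True then show thesis using that[of 1] by simp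
  next
    case False
    have "Min (radius ` P) \<in> radius ` P" using radii_finite False by (intro Min_in) auto
    then have "Min (radius ` P) > 0" using packing_radius_pos[OF packing] by auto
    then show thesis using that[of "Min (radius ` P)"] radii_finite by auto
  qed
  \<comment> \<open>The centers are separated by \<open>r\<close>, so a bounded set of them has no limit point.\<close>
  have far: "r \<le> dist (center d) (center e)" if "d \<in> P" "e \<in> P" "d \<noteq> e" for d e
    using packing_dist_ge[OF packing that] r(2)[OF that(1)] r(2)[OF that(2)] r(1) by linarith
  have inj: "inj_on center ?Q"
  proof (rule inj_onI, rule ccontr)
    fix d e assume "d \<in> ?Q" "e \<in> ?Q" "center d = center e" "d \<noteq> e"
    then show False using far[of d e] r(1) by simp
  qed
  have "finite (center ` ?Q)"
  proof (rule ccontr)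
    assume inf: "infinite (center ` ?Q)"
    have "bounded (center ` ?Q)"
      by (rule bounded_subset[of "cball x M"]) auto
    then obtain y where "y islimpt center ` ?Q"
      using bounded_infinite_imp_islimpt[OF subset_refl _ inf] by blast
    then have i: "infinite (center ` ?Q \<inter> ball y (r / 2))"
      using r(1) by (simp add: islimpt_eq_infinite_ball)
    then obtain p where p: "p \<in> center ` ?Q" "p \<in> ball y (r / 2)"
      using infinite_imp_nonempty by blast
    have "infinite (center ` ?Q \<inter> ball y (r / 2) - {p})" using i by simp
    then obtain q where q: "q \<in> center ` ?Q" "q \<in> ball y (r / 2)" "q \<noteq> p"
      using infinite_imp_nonempty by blast
    have "dist p q < r" using p(2) q(2) dist_triangle_half_r[of y p r q] by simp
    moreover have "r \<le> dist p q" using far p(1) q(1,3) by force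
    ultimately show False by simp
  qed
  then show ?thesis using inj by (rule finite_imageD)
qed

text \<open>The closed faces spanned by three disks with radius in \<open>R\<close>.\<close>

definition face_hulls :: "real set \<Rightarrow> (real^2) set set"
  where "face_hulls R = {convex hull {center a, center b, center c} | a b c.
    face_triple P a b c \<and> radius a \<in> R \<and> radius b \<in> R \<and> radius c \<in> R}"

lemma face_hullsI:
  assumes "face_triple P a b c" "radius a \<in> R" "radius b \<in> R" "radius c \<in> R"
  shows "convex hull {center a, center b, center c} \<in> face_hulls R"
  unfolding face_hulls_def using assms by blast

lemma face_hullsE:
  assumes "S \<in> face_hulls R"
  obtains a b c where "face_triple P a b c" "radius a \<in> R" "radius b \<in> R" "radius c \<in> R"
    "S = convex hull {center a, center b, center c}"
  using assms unfolding face_hulls_def by blast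

lemma center_in_face_hulls:
  assumes h: "h \<in> P" "center h \<in> \<Union>(face_hulls R)"
  shows "radius h \<in> R"
proof -
  obtain S where S: "S \<in> face_hulls R" "center h \<in> S" using h(2) by blast
  obtain a b c where f: "face_triple P a b c" "S = convex hull {center a, center b, center c}"
    and r: "radius a \<in> R" "radius b \<in> R" "radius c \<in> R"
    using S(1) by (rule face_hullsE)
  have "center h \<in> disk_region h" using packing_radius_pos[OF packing h(1)] by (simp add: disk_region_def)
  with S(2) have "h \<in> {a, b, c}"
    unfolding f(2) by (rule face_triple_disk_at_point[OF packing f(1) _ center_in_contact_graph[OF h(1)] h(1)])
  then show ?thesis using r by blast
qed

lemma closed_Union_face_hulls: "closed (\<Union>(face_hulls R))"
proof -
  obtain M where M: "\<And>d. d \<in> P \<Longrightarrow> radius d \<le> M"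
    using Max_ge[OF radii_finite] by blast
  have "closedin euclidean (\<Union>(face_hulls R))"
  proof (rule closedin_locally_finite_Union)
    fix S assume "S \<in> face_hulls R"
    then obtain a b c where "S = convex hull {center a, center b, center c}" by (rule face_hullsE)
    then show "closedin euclidean S"
      by (simp add: compact_imp_closed compact_convex_hull finite_imp_compact)
  next
    have "finite {S \<in> face_hulls R. S \<inter> ball x 1 \<noteq> {}}" for x
    proof -
      let ?Q = "{d\<in>P. dist x (center d) \<le> 1 + 2 * M}"
      have fin: "finite (?Q \<times> ?Q \<times> ?Q)" using finitely_many_disks_near by blast
      have "{S \<in> face_hulls R. S \<inter> ball x 1 \<noteq> {}} \<subseteq>
        (\<lambda>(a, b, c). convex hull {center a, center b, center c}) ` (?Q \<times> ?Q \<times> ?Q)"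
      proof
        fix S assume "S \<in> {S \<in> face_hulls R. S \<inter> ball x 1 \<noteq> {}}"
        then have "S \<in> face_hulls R" and "S \<inter> ball x 1 \<noteq> {}" by auto
        then obtain y where y: "y \<in> S" "dist x y < 1" by auto
        obtain a b c where f: "face_triple P a b c" and S: "S = convex hull {center a, center b, center c}"
          using \<open>S \<in> face_hulls R\<close> by (rule face_hullsE)
        have P: "a \<in> P" "b \<in> P" "c \<in> P" and t: "dist (center a) (center b) = radius a + radius b"
          "dist (center b) (center c) = radius b + radius c" "dist (center c) (center a) = radius c + radius a"
          using f by (auto simp: face_triple_def tangent_def)
        have near: "d \<in> ?Q" if d: "d \<in> {a, b, c}" for d
        proof -
          have "dist (center d) (center e) \<le> 2 * M" if "e \<in> {a, b, c}" for e
            using that d t M[OF P(1)] M[OF P(2)] M[OF P(3)] packing_radius_pos[OF packing P(1)]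
            by (auto simp: dist_commute)
          then have "{center a, center b, center c} \<subseteq> cball (center d) (2 * M)" by auto
          then have "S \<subseteq> cball (center d) (2 * M)" unfolding S by (rule hull_minimal) simp
          then have "dist (center d) y \<le> 2 * M" using y(1) by auto
          then have "dist x (center d) \<le> 1 + 2 * M"
            using y(2) dist_triangle[of x "center d" y] by (simp add: dist_commute)
          then show ?thesis using d P by blast
        qed
        have "(a, b, c) \<in> ?Q \<times> ?Q \<times> ?Q" using near[of a] near[of b] near[of c] by blast
        then show "S \<in> (\<lambda>(a, b, c). convex hull {center a, center b, center c}) ` (?Q \<times> ?Q \<times> ?Q)"
          unfolding S by (rule rev_image_eqI) simp
      qed
      then show ?thesis using finite_subset finite_imageI[OF fin] by blast
    qed
    then show "locally_finite_in euclidean (face_hulls R)"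
      unfolding locally_finite_in_def
    proof (intro conjI ballI)
      fix x :: "real^2"
      show "\<exists>V. openin euclidean V \<and> x \<in> V \<and> finite {S \<in> face_hulls R. S \<inter> V \<noteq> {}}"
        using \<open>\<And>x. finite {S \<in> face_hulls R. S \<inter> ball x 1 \<noteq> {}}\<close>[of x]
        by (intro exI[of _ "ball x 1"]) simp
    qed simp
  qed
  then show ?thesis by simp
qed

text \<open>If every face had three equal radii, then, by \<open>face_triples_common_vertex\<close>, the closed
  faces with the radius of \<open>d\<close> and those with another radius would split the plane into two disjoint
  nonempty closed sets.\<close>

lemma exists_face_unequal_radii:
  assumes de: "d \<in> P" "e \<in> P" "radius d \<noteq> radius e"
  obtains a b c where "face_triple P a b c" "\<not> (radius a = radius b \<and> radius b = radius c)"
proof (rule ccontr)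
  assume "\<not> thesis"
  then have mono: "radius a = radius b \<and> radius b = radius c" if "face_triple P a b c" for a b c
    using that \<open>\<And>a b c. face_triple P a b c \<Longrightarrow> \<not> (radius a = radius b \<and> radius b = radius c) \<Longrightarrow> thesis\<close> by blast
  define A where "A = \<Union>(face_hulls {radius d})"
  define B where "B = \<Union>(face_hulls (- {radius d}))"
  have closed: "closed A" "closed B" using closed_Union_face_hulls by (auto simp: A_def B_def)
  have "interior (contact_graph P) = {}"
    using negligible_contact_graph negligible_subset interior_subset open_interior open_not_negligible by metis
  then have dense: "closure (- contact_graph P) = UNIV" by (simp add: closure_complement)
  have "- contact_graph P \<subseteq> A \<union> B"
  proof
    fix x assume "x \<in> - contact_graph P"
    then obtain T where T: "T \<in> faces P" "x \<in> T"
      unfolding faces_def using Union_components[of "- contact_graph P"] by blast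
    obtain a b c where f: "face_triple P a b c" "T = interior (convex hull {center a, center b, center c})"
      using face_obtain_triple[OF triangulated T(1)] .
    then have "x \<in> convex hull {center a, center b, center c}" using T(2) interior_subset by blast
    moreover have "convex hull {center a, center b, center c} \<in> face_hulls {radius d} \<union> face_hulls (- {radius d})"
      using face_hullsI[OF f(1), of "{radius d}"] face_hullsI[OF f(1), of "- {radius d}"] mono[OF f(1)]
      by auto
    ultimately show "x \<in> A \<union> B" unfolding A_def B_def by blast
  qed
  then have "closure (- contact_graph P) \<subseteq> A \<union> B" using closed by (intro closure_minimal closed_Un)
  then have cover: "UNIV \<subseteq> A \<union> B" by (simp add: dense)
  have disj: "A \<inter> B = {}"
  proof (rule ccontr)
    assume "A \<inter> B \<noteq> {}"
    then obtain x S S' where S: "S \<in> face_hulls {radius d}" "x \<in> S"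
      and S': "S' \<in> face_hulls (- {radius d})" "x \<in> S'"
      unfolding A_def B_def by blast
    obtain a b c where f: "face_triple P a b c" "S = convex hull {center a, center b, center c}"
      and r: "radius a \<in> {radius d}" "radius b \<in> {radius d}" "radius c \<in> {radius d}"
      using S(1) by (rule face_hullsE)
    obtain a' b' c' where f': "face_triple P a' b' c'" "S' = convex hull {center a', center b', center c'}"
      and r': "radius a' \<in> - {radius d}" "radius b' \<in> - {radius d}" "radius c' \<in> - {radius d}"
      using S'(1) by (rule face_hullsE)
    from face_triples_common_vertex[OF packing f(1) f'(1)] show False
      using S(2) S'(2) r r' unfolding f(2) f'(2) by auto
  qed
  have "center d \<notin> B" "center e \<notin> A"
    using center_in_face_hulls[OF de(1), of "- {radius d}"] center_in_face_hulls[OF de(2), of "{radius d}"]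
      de(3)[symmetric]
    unfolding A_def B_def by blast+
  then have "center d \<in> A" "center e \<in> B" using cover by blast+
  then show False
    using connected_UNIV[where 'a = "real^2"] closed cover disj unfolding connected_closed by blast
qed


section \<open>The density of the packing\<close>

lemma exists_strict_representative:
  assumes "d \<in> P" "e \<in> P" "radius d \<noteq> radius e"
  obtains T where "T \<in> face_representatives" "hex_density * measure lebesgue T < measure lebesgue (U \<inter> T)"
proof -
  obtain a b c where f: "face_triple P a b c" "\<not> (radius a = radius b \<and> radius b = radius c)"
    using exists_face_unequal_radii[OF assms] .
  define T where "T = interior (convex hull {center a, center b, center c})"
  have T: "T \<in> faces P" using f(1) by (simp add: T_def face_triple_def)
  obtain w where w: "w \<in> L" "anchor T - w \<in> fundamental_region u v"
    using lattice_translate_into_region[OF basis] .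
  have "anchor ((+) (- w) ` T) = anchor T - w"
    unfolding anchor_translation[OF face_open_bounded(2,3)[OF T]] by simp
  then have rep: "(+) (- w) ` T \<in> face_representatives"
    using w(2) face_translate[OF T lattice_gen_minus[OF w(1)]] by (simp add: face_representatives_def)
  have "U \<inter> (+) (- w) ` T = (+) (- w) ` (U \<inter> T)"
    using covered_set_invariant[OF lattice_gen_minus[OF w(1)]] by (simp add: image_Int)
  then have "hex_density * measure lebesgue ((+) (- w) ` T) < measure lebesgue (U \<inter> (+) (- w) ` T)"
    using face_density(2)[OF f] by (simp only: measure_translation T_def)
  then show thesis using that rep by blast
qed

lemma representatives_density:
  assumes "D \<subseteq> face_representatives"
  shows "ennreal hex_density * emeasure lebesgue (\<Union>D) \<le> emeasure lebesgue (U \<inter> \<Union>D)"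
proof -
  have faces: "T \<in> faces P" if "T \<in> D" for T using that assms by (auto simp: face_representatives_def)
  have c: "countable D" using faces by (intro countable_subset[OF _ countable_faces]) blast
  have T: "T \<in> lmeasurable" "U \<inter> T \<in> lmeasurable" if "T \<in> D" for T
  proof -
    show "T \<in> lmeasurable" using face_open_bounded(1,2)[OF faces[OF that]] by (simp add: lmeasurable_open)
    then show "U \<inter> T \<in> lmeasurable"
      using fmeasurable_Int_fmeasurable[OF _ covered_set_measurable] by (simp add: Int_commute)
  qed
  have disj: "disjoint_family_on (\<lambda>T. T) D" "disjoint_family_on (\<lambda>T. U \<inter> T) D"
    using faces_disjoint faces unfolding disjoint_family_on_def by blast+
  have "ennreal hex_density * emeasure lebesgue (\<Union>D) = (\<integral>\<^sup>+T. ennreal hex_density * emeasure lebesgue T \<partial>count_space D)"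
    using emeasure_UN_countable[of D "\<lambda>T. T" lebesgue, OF _ c disj(1)] T(1)
    by (simp add: nn_integral_cmult fmeasurableD)
  also have "\<dots> \<le> (\<integral>\<^sup>+T. emeasure lebesgue (U \<inter> T) \<partial>count_space D)"
  proof (rule nn_integral_mono)
    fix T assume "T \<in> space (count_space D)"
    then have TD: "T \<in> D" by simp
    obtain a b c where f: "face_triple P a b c" "T = interior (convex hull {center a, center b, center c})"
      using face_obtain_triple[OF triangulated faces[OF TD]] .
    have "ennreal hex_density * emeasure lebesgue T = ennreal (hex_density * measure lebesgue T)"
      using hex_density_bounds(1) by (simp add: emeasure_eq_measure2[OF T(1)[OF TD]] ennreal_mult)
    also have "\<dots> \<le> ennreal (measure lebesgue (U \<inter> T))"
      using face_density(1)[OF f(1)] by (intro ennreal_leI) (simp only: f(2))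
    also have "\<dots> = emeasure lebesgue (U \<inter> T)" by (simp add: emeasure_eq_measure2[OF T(2)[OF TD]])
    finally show "ennreal hex_density * emeasure lebesgue T \<le> emeasure lebesgue (U \<inter> T)" .
  qed
  also have "\<dots> = emeasure lebesgue (\<Union>T\<in>D. U \<inter> T)"
    using emeasure_UN_countable[of D "\<lambda>T. U \<inter> T" lebesgue, OF _ c disj(2)] T(2) by (simp add: fmeasurableD)
  also have "(\<Union>T\<in>D. U \<inter> T) = U \<inter> \<Union>D" by blast
  finally show ?thesis .
qed

lemma packing_density_gt:
  assumes "d \<in> P" "e \<in> P" "radius d \<noteq> radius e"
  shows "hex_density < packing_density P u v"
proof -
  let ?F = "fundamental_region u v"
  let ?E = "\<Union>face_representatives"
  obtain T where T: "T \<in> face_representatives"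
    and strict: "hex_density * measure lebesgue T < measure lebesgue (U \<inter> T)"
    using exists_strict_representative[OF assms] .
  define R where "R = \<Union>(face_representatives - {T})"
  have E: "?E = T \<union> R" using T by (auto simp: R_def)
  have TR: "T \<inter> R = {}" using T faces_disjoint by (auto simp: R_def face_representatives_def)
  have open_T: "open T" and open_R: "open R"
    using T face_open_bounded(1) by (auto simp: R_def face_representatives_def)
  have Em: "?E \<in> lmeasurable"
  proof -
    have "?E \<in> sets lebesgue" using tiles_face_representatives by (simp add: tiles_def)
    then show ?thesis
      using region_measures_eq(2) fundamental_region_measurable[of u v] by (auto simp: fmeasurable_def)
  qed
  have meas: "T \<in> lmeasurable" "R \<in> lmeasurable"
    using fmeasurable_Int_fmeasurable[OF Em, of T] fmeasurable_Int_fmeasurable[OF Em, of R] open_T open_R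
    by (auto simp: E Int_absorb1 Int_absorb2 Int_Un_distrib2)
  have Umeas: "U \<inter> S \<in> lmeasurable" if "S \<in> lmeasurable" for S
    using fmeasurable_Int_fmeasurable[OF that covered_set_measurable] by (simp add: Int_commute)
  have R: "hex_density * measure lebesgue R \<le> measure lebesgue (U \<inter> R)"
  proof -
    have "ennreal (hex_density * measure lebesgue R) \<le> ennreal (measure lebesgue (U \<inter> R))"
      using representatives_density[of "face_representatives - {T}"] hex_density_bounds(1)
      by (simp add: ennreal_mult flip: R_def emeasure_eq_measure2[OF meas(2)] emeasure_eq_measure2[OF Umeas[OF meas(2)]])
    then show ?thesis by simp
  qed
  have "hex_density * measure lebesgue ?F = hex_density * measure lebesgue ?E"
    using region_measures_eq(2) by (simp add: measure_def)
  also have "measure lebesgue ?E = measure lebesgue T + measure lebesgue R"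
    using meas TR by (simp add: E measure_Un3)
  also have "hex_density * (measure lebesgue T + measure lebesgue R) < measure lebesgue (U \<inter> T) + measure lebesgue (U \<inter> R)"
    using strict R by (simp add: distrib_left)
  also have "\<dots> = measure lebesgue ((U \<inter> T) \<union> (U \<inter> R))"
  proof -
    have "(U \<inter> T) \<inter> (U \<inter> R) = {}" using TR by blast
    then show ?thesis using Umeas[OF meas(1)] Umeas[OF meas(2)] by (subst measure_Un3) simp_all
  qed
  also have "(U \<inter> T) \<union> (U \<inter> R) = U \<inter> ?E" unfolding E by blast
  also have "measure lebesgue (U \<inter> ?E) = measure lebesgue (U \<inter> ?F)"
    using region_measures_eq(1) by (simp only: measure_def)
  finally have lt: "hex_density * measure lebesgue ?F < measure lebesgue (U \<inter> ?F)" .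
  \<comment> \<open>The strict inequality itself excludes that the parallelogram has area zero.\<close>
  have "measure lebesgue (U \<inter> ?F) \<le> measure lebesgue ?F"
    using fundamental_region_measurable covered_set_measurable by (intro measure_mono_fmeasurable) (auto simp: fmeasurableD)
  then have "measure lebesgue ?F > 0" using lt zero_less_measure_iff[of lebesgue ?F]
    by (cases "measure lebesgue ?F = 0") auto
  then show ?thesis using lt by (simp add: packing_density_def pos_less_divide_eq)
qed

end

theorem corollary2p4:
  fixes P :: "disk set" and u v :: "real^2"
  assumes "disk_packing P"
    and "doubly_periodic P u v"
    and "triangulated P"
    and "\<exists>d\<in>P. \<exists>e\<in>P. radius d \<noteq> radius e"
  shows "packing_density P u v > pi / sqrt 12"
proof -
  interpret compact_packing P u v using assms(1-3) by unfold_locales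
  show ?thesis using packing_density_gt assms(4) unfolding hex_density_def by blast
qed

end
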